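(* Let $\{X_n\}_{n \ge 0}$ be an irreducible, aperiodic, positive recurrent Markov chain on a countable state space $S$ with stationary distribution $\pi$. Suppose the chain is long range dependent with Hurst parameter $H$, and suppose that there are a state $j \in S$ and a real $\alpha$ with $1 < \alpha < 2$ such that the return time $T_{jj}$ satisfies $\mathbb{P}(T_{jj} > n) \sim n^{-\alpha}$ as $n \to \infty$. Then the $n$-step transition probabilities converge to $\pi$ at rate $O(n^{2H-2})$ in the following sense: for every real $\beta$ with $H < \beta < 1$ and every $i \in S$, $$n^{2-2\beta}\, \| p^n_{i\,\cdot} - \pi(\cdot) \|_{TV} \to 0 \quad \text{as } n \to \infty.$$
   Context: $p^n_{ij} = \mathbb{P}(X_{k+n} = j \mid X_k = i)$ are the $n$-step transition probabilities, and $p^n_{i\,\cdot}$ is the probability distribution $j \mapsto p^n_{ij}$ on $S$. The total variation distance is $\|\mu-\nu\|_{TV} = \sup_{A \subseteq S} |\mu(A)-\nu(A)|$. The return time to state $j$ is $T_{jj} = \inf\{n \ge 1 : X_n = j\}$ for the chain started at $X_0 = j$. The notation $a_n \sim b_n$ means $a_n/b_n \to 1$. Long range dependence: an irreducible and aperiodic chain is long range dependent (LRD) if $\limsup_{n\to\infty} \mathrm{Var}(N_i(0,n])/n = \infty$, where $N_i(0,n] = \sum_{k=1}^n \mathbf{1}_{\{X_k = i\}}$ is the number of visits to state $i$ up to time $n$ and the variance is taken for the stationary chain; this property does not depend on the choice of state $i$. Hurst parameter: for a stationary process with autocovariance $\gamma(k)$, $H = \inf\{h : \limsup_{n\to\infty}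 \frac{\sum_{r=1}^n \gamma(r)}{n^{2h-1}} < \infty\}$. For the Markov chain, $\gamma(k) = \mathrm{Cov}(\mathbf{1}_{\{X_0=i\}}, \mathbf{1}_{\{X_k=i\}})$ is the autocovariance of the indicator process of visits to a state $i$ under the stationary chain (the value of $H$ does not depend on $i$). *)

theory Defs
  imports "HOL-Probability.Probability" "HOL-Library.Landau_Symbols"
begin

section \<open>The law of a Markov chain\<close>

text \<open>
  A countable state space is a type of class \<open>countable\<close>, and a transition matrix is a function
  \<open>K\<close> such that \<open>pmf (K i) j\<close> is the transition probability from \<open>i\<close> to \<open>j\<close>. The time-homogeneous
  chain with transition matrix \<open>K\<close> and initial distribution \<open>\<mu>\<close> is realised on its path space:
  \<open>chain_law K \<mu>\<close> is the Ionescu-Tulcea measure on \<open>nat \<Rightarrow> 's\<close>, under which \<open>X\<^sub>n\<close> is the coordinate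
  \<open>\<lambda>\<omega>. \<omega> n\<close>. Its finite-dimensional distributions are given by \<open>chain_law_fdd\<close> below. The chain
  started at \<open>i\<close> has law \<open>chain_law K (return_pmf i)\<close>, and the stationary chain has law
  \<open>chain_law K \<pi>\<close> where \<open>\<pi>\<close> is the stationary distribution.
\<close>

definition chain_step ::
    "('s::countable \<Rightarrow> 's pmf) \<Rightarrow> 's pmf \<Rightarrow> nat \<Rightarrow> (nat \<Rightarrow> 's) \<Rightarrow> 's measure" where
  "chain_step K \<mu> n \<omega> = measure_pmf (case n of 0 \<Rightarrow> \<mu> | Suc m \<Rightarrow> K (\<omega> m))"

global_interpretation chain: Ionescu_Tulcea "chain_step K \<mu>" "\<lambda>_. count_space UNIV"
  for K :: "'s::countable \<Rightarrow> 's pmf" and \<mu> :: "'s pmf"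
proof (rule Ionescu_Tulcea.intro)
  fix i
  show "chain_step K \<mu> i \<in> PiM {0..<i} (\<lambda>_. count_space UNIV) \<rightarrow>\<^sub>M subprob_algebra (count_space UNIV)"
  proof (cases i)
    case 0
    have "measure_pmf \<mu> \<in> space (subprob_algebra (count_space UNIV))"
      by (simp add: measure_pmf_in_subprob_space)
    then show ?thesis
      unfolding chain_step_def 0 by simp
  next
    case (Suc m)
    have "(\<lambda>\<omega>. \<omega> m) \<in> PiM {0..<i} (\<lambda>_. count_space (UNIV :: 's set)) \<rightarrow>\<^sub>M count_space UNIV"
      by (rule measurable_component_singleton) (simp add: Suc)
    then have "(\<lambda>\<omega>. measure_pmf (K (\<omega> m)))
        \<in> PiM {0..<i} (\<lambda>_. count_space UNIV) \<rightarrow>\<^sub>M subprob_algebra (count_space UNIV)"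
      by (rule measurable_compose) (simp add: measure_pmf_in_subprob_space)
    then show ?thesis
      unfolding chain_step_def Suc by simp
  qed
next
  show "prob_space (chain_step K \<mu> i \<omega>)" for i and \<omega> :: "nat \<Rightarrow> 's"
    unfolding chain_step_def by (rule measure_pmf.prob_space_axioms)
qed

definition chain_law :: "('s::countable \<Rightarrow> 's pmf) \<Rightarrow> 's pmf \<Rightarrow> (nat \<Rightarrow> 's) measure" where
  "chain_law K \<mu> = chain.PF.lim K \<mu>"

lemma space_chain_law [simp]: "space (chain_law K \<mu>) = UNIV"
  unfolding chain_law_def chain.PF.space_lim by (simp add: space_PiM)

lemma sets_chain_law [measurable_cong]:
  "sets (chain_law K \<mu>) = sets (PiM UNIV (\<lambda>_. count_space UNIV))"
  unfolding chain_law_def by (rule chain.PF.sets_lim)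

lemma emeasure_chain_C:
  fixes x :: "nat \<Rightarrow> 's::countable"
  shows "emeasure (chain.C K \<mu> 0 m (\<lambda>_. undefined)) {restrict x {0..<m}}
     = (\<Prod>k<m. ennreal (pmf (case k of 0 \<Rightarrow> \<mu> | Suc l \<Rightarrow> K (x l)) (x k)))"
proof (induction m)
  case 0
  have "{\<lambda>_. undefined} = space (PiM ({} :: nat set) (\<lambda>_. count_space (UNIV :: 's set)))"
    by (simp add: space_PiM)
  then have "{\<lambda>_. undefined} \<in> sets (PiM ({} :: nat set) (\<lambda>_. count_space (UNIV :: 's set)))"
    by (metis sets.top)
  then show ?case
    by (simp add: restrict_def)
next
  case (Suc m)
  let ?M = "\<lambda>J. PiM J (\<lambda>_. count_space (UNIV :: 's set))"
  let ?u = "\<lambda>_. undefined :: 's" and ?r = "\<lambda>m. restrict x {0..<m}"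
  let ?p = "\<lambda>k. pmf (case k of 0 \<Rightarrow> \<mu> | Suc l \<Rightarrow> K (x l)) (x k)"
  have u: "?u \<in> space (?M {0..<0})"
    by (auto simp: space_PiM)
  have single: "{?r k} \<in> sets (?M {0..<k})" for k
  proof -
    have "PiE {0..<k} (\<lambda>i. {x i}) \<in> sets (?M {0..<k})"
      by (rule sets_PiM_I_finite) auto
    moreover have "PiE {0..<k} (\<lambda>i. {x i}) = {?r k}"
      by (auto simp: PiE_iff extensional_def fun_eq_iff)
    ultimately show ?thesis
      by simp
  qed
  have eP: "emeasure (chain.eP K \<mu> m y) {?r (Suc m)} = ennreal (?p m) * indicator {?r m} y"
    if y: "y \<in> space (?M {0..<m})" for y
  proof -
    have ext: "y k = undefined" if "\<not> k < m" for k
      using y that by (simp add: space_PiM PiE_iff extensional_def)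
    have "y = ?r m \<and> z = x m" if "y(m := z) = ?r (Suc m)" for z
    proof
      show "y = ?r m"
      proof
        show "y k = ?r m k" for k
          using fun_cong[OF that, of k] ext[of k] by (cases k m rule: linorder_cases) auto
      qed
      show "z = x m"
        using fun_cong[OF that, of m] by simp
    qed
    moreover have "(?r m)(m := x m) = ?r (Suc m)"
      by (auto simp: fun_eq_iff less_Suc_eq)
    ultimately have "(fun_upd y m) -` {?r (Suc m)} \<inter> space (count_space UNIV)
        = (if y = ?r m then {x m} else {})"
      by (auto simp del: restrict_apply)
    then have "emeasure (chain.eP K \<mu> m y) {?r (Suc m)}
        = emeasure (chain_step K \<mu> m y) (if y = ?r m then {x m} else {})"
      using chain.emeasure_eP[OF y single[of "Suc m"]] by simp
    also have "\<dots> = ennreal (?p m) * indicator {?r m} y"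
      by (auto simp: chain_step_def emeasure_pmf_single split: nat.split)
    finally show ?thesis .
  qed
  have "emeasure (chain.C K \<mu> 0 (Suc m) ?u) {?r (Suc m)}
      = (\<integral>\<^sup>+y. emeasure (chain.eP K \<mu> m y) {?r (Suc m)} \<partial>chain.C K \<mu> 0 m ?u)"
  proof -
    have ne: "space (chain.C K \<mu> 0 m ?u) \<noteq> {}"
      using chain.prob_space_C[OF u] by (rule prob_space.not_empty)
    have "chain.eP K \<mu> m \<in> chain.C K \<mu> 0 m ?u \<rightarrow>\<^sub>M subprob_algebra (?M {0..<Suc m})"
      using chain.measurable_eP[of K \<mu> m] chain.sets_C[OF u, of K \<mu> m]
      by (simp cong: measurable_cong_sets)
    from emeasure_bind[OF ne this single] show ?thesis
      by simp
  qed
  also have "\<dots> = (\<integral>\<^sup>+y. ennreal (?p m) * indicator {?r m} y \<partial>chain.C K \<mu> 0 m ?u)"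
    by (rule nn_integral_cong) (simp add: chain.space_C[OF u] eP)
  also have "\<dots> = ennreal (?p m) * emeasure (chain.C K \<mu> 0 m ?u) {?r m}"
    by (rule nn_integral_cmult_indicator) (simp add: chain.sets_C[OF u] single)
  also have "\<dots> = (\<Prod>k<Suc m. ennreal (?p k))"
    by (simp add: Suc.IH mult.commute)
  finally show ?case .
qed

lemma prob_space_chain_law: "prob_space (chain_law K \<mu>)"
proof (rule prob_spaceI)
  let ?M = "\<lambda>J. PiM J (\<lambda>_. count_space UNIV)"
  have "prod_emb UNIV (\<lambda>_. count_space UNIV) {} (space (?M {})) = space (chain_law K \<mu>)"
    by (auto simp: prod_emb_def space_PiM)
  moreover have "emeasure (chain_law K \<mu>) (prod_emb UNIV (\<lambda>_. count_space UNIV) {} (space (?M {})))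
      = emeasure (chain.CI K \<mu> {}) (space (?M {}))"
    unfolding chain_law_def by (rule chain.lim) auto
  moreover have "space (chain.CI K \<mu> {}) = space (?M {})"
    by (rule chain.PF.space_P) auto
  moreover have "prob_space (chain.CI K \<mu> {})"
    by (rule chain.PF.prob_space_P) auto
  ultimately show "emeasure (chain_law K \<mu>) (space (chain_law K \<mu>)) = 1"
    by (metis prob_space.emeasure_space_1)
qed

lemma chain_law_fdd:
  fixes x :: "nat \<Rightarrow> 's::countable"
  shows "measure (chain_law K \<mu>) {\<omega>. \<forall>k\<le>n. \<omega> k = x k}
     = pmf \<mu> (x 0) * (\<Prod>k<n. pmf (K (x k)) (x (Suc k)))"
proof -
  let ?M = "\<lambda>J. PiM J (\<lambda>_. count_space (UNIV :: 's set))"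
  let ?J = "{0..<Suc n}"
  let ?emb = "\<lambda>L. prod_emb L (\<lambda>_. count_space (UNIV :: 's set)) ?J"
  have "PiE ?J (\<lambda>i. {x i}) \<in> sets (?M ?J)"
    by (rule sets_PiM_I_finite) auto
  moreover have "PiE ?J (\<lambda>i. {x i}) = {restrict x ?J}"
    by (auto simp: PiE_iff extensional_def fun_eq_iff)
  ultimately have single: "{restrict x ?J} \<in> sets (?M ?J)"
    by simp
  have "(restrict \<omega> ?J = restrict x ?J) \<longleftrightarrow> (\<forall>k\<le>n. \<omega> k = x k)" for \<omega> :: "nat \<Rightarrow> 's"
    unfolding fun_eq_iff by (auto simp: less_Suc_eq_le)
  then have "{\<omega>. \<forall>k\<le>n. \<omega> k = x k} = ?emb UNIV {restrict x ?J}"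
    by (auto simp: prod_emb_def simp del: restrict_apply)
  then have "emeasure (chain_law K \<mu>) {\<omega>. \<forall>k\<le>n. \<omega> k = x k}
      = emeasure (chain.CI K \<mu> ?J) {restrict x ?J}"
    unfolding chain_law_def by (simp only: chain.lim[OF _ single] finite_atLeastLessThan)
  also have "\<dots> = emeasure (chain.C K \<mu> 0 (Suc n) (\<lambda>_. undefined)) (?emb ?J {restrict x ?J})"
    by (rule chain.emeasure_CI[OF order_refl single])
  also have "?emb ?J {restrict x ?J} = {restrict x ?J}"
    by (rule prod_emb_id) (auto simp: PiE_iff)
  also have "emeasure (chain.C K \<mu> 0 (Suc n) (\<lambda>_. undefined)) {restrict x ?J}
      = ennreal (\<Prod>k<Suc n. pmf (case k of 0 \<Rightarrow> \<mu> | Suc l \<Rightarrow> K (x l)) (x k))"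
    by (simp only: emeasure_chain_C prod_ennreal[OF pmf_nonneg])
  also have "(\<Prod>k<Suc n. pmf (case k of 0 \<Rightarrow> \<mu> | Suc l \<Rightarrow> K (x l)) (x k))
      = pmf \<mu> (x 0) * (\<Prod>k<n. pmf (K (x k)) (x (Suc k)))"
    by (simp only: prod.lessThan_Suc_shift nat.case)
  finally show ?thesis
    by (simp add: measure_def prod_nonneg)
qed

section \<open>Notions for Markov chains\<close>

text \<open>
  The distribution \<open>p\<^sup>n\<close> from \<open>i\<close> is taken under the chain started at \<open>i\<close>, so that it is defined for
  every \<open>i\<close> without conditioning on the event \<open>X\<^sub>k = i\<close>.
\<close>

definition nstep :: "('s::countable \<Rightarrow> 's pmf) \<Rightarrow> nat \<Rightarrow> 's \<Rightarrow> 's measure" where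
  "nstep K n i = distr (chain_law K (return_pmf i)) (count_space UNIV) (\<lambda>\<omega>. \<omega> n)"

definition tv_dist :: "'a measure \<Rightarrow> 'a measure \<Rightarrow> real" where
  "tv_dist M N = (SUP A\<in>sets M. \<bar>measure M A - measure N A\<bar>)"

definition irreducible_chain :: "('s::countable \<Rightarrow> 's pmf) \<Rightarrow> bool" where
  "irreducible_chain K \<longleftrightarrow> (\<forall>i j. \<exists>n. measure (nstep K n i) {j} > 0)"

definition aperiodic_chain :: "('s::countable \<Rightarrow> 's pmf) \<Rightarrow> bool" where
  "aperiodic_chain K \<longleftrightarrow> (\<forall>i. Gcd {n. n \<ge> 1 \<and> measure (nstep K n i) {i} > 0} = 1)"

definition return_time :: "'s \<Rightarrow> (nat \<Rightarrow> 's) \<Rightarrow> enat" where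
  "return_time j \<omega> = Inf {enat n |n. n \<ge> 1 \<and> \<omega> n = j}"

definition positive_recurrent :: "('s::countable \<Rightarrow> 's pmf) \<Rightarrow> bool" where
  "positive_recurrent K \<longleftrightarrow>
     (\<forall>j. (\<integral>\<^sup>+\<omega>. ennreal_of_enat (return_time j \<omega>) \<partial>chain_law K (return_pmf j)) < \<infinity>)"

definition stationary_distribution :: "('s \<Rightarrow> 's pmf) \<Rightarrow> 's pmf \<Rightarrow> bool" where
  "stationary_distribution K \<pi> \<longleftrightarrow> bind_pmf \<pi> K = \<pi>"

definition visits :: "'s \<Rightarrow> nat \<Rightarrow> (nat \<Rightarrow> 's) \<Rightarrow> real" where
  "visits i n \<omega> = (\<Sum>k=1..n. indicator {i} (\<omega> k))"

definition covariance :: "'a measure \<Rightarrow> ('a \<Rightarrow> real) \<Rightarrow> ('a \<Rightarrow> real) \<Rightarrow> real" where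
  "covariance M X Y =
     integral\<^sup>L M (\<lambda>\<omega>. (X \<omega> - integral\<^sup>L M X) * (Y \<omega> - integral\<^sup>L M Y))"

text \<open>
  The infimum is taken in the extended reals: the set of exponents may be empty or unbounded below.
\<close>

definition hurst :: "'a measure \<Rightarrow> (nat \<Rightarrow> 'a \<Rightarrow> real) \<Rightarrow> ereal" where
  "hurst M Y = Inf {ereal h |h.
     limsup (\<lambda>n. ereal ((\<Sum>r=1..n. covariance M (Y 0) (Y r)) / real n powr (2 * h - 1))) < \<infinity>}"

text \<open>
  For a long range dependent chain neither long range dependence nor the Hurst parameter depends on
  the reference state \<open>i\<close>; of the equivalent readings, the one required at some state is assumed.
\<close>

definition long_range_dependent :: "('s::countable \<Rightarrow> 's pmf) \<Rightarrow> 's pmf \<Rightarrow> bool" where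
  "long_range_dependent K \<pi> \<longleftrightarrow>
     (\<exists>i. limsup (\<lambda>n. ereal (prob_space.variance (chain_law K \<pi>) (visits i n) / real n)) = \<infinity>)"

definition has_hurst_parameter :: "('s::countable \<Rightarrow> 's pmf) \<Rightarrow> 's pmf \<Rightarrow> real \<Rightarrow> bool" where
  "has_hurst_parameter K \<pi> H \<longleftrightarrow>
     (\<exists>i. hurst (chain_law K \<pi>) (\<lambda>k \<omega>. indicator {i} (\<omega> k)) = ereal H)"

end

theory Submission
  imports Defs "HOL-Complex_Analysis.Complex_Analysis" "HOL-Real_Asymp.Real_Asymp"
begin

text \<open>
  Two facts are combined. First, the return time tail forces \<open>H \<ge> (3 - \<alpha>)/2\<close>. For the state \<open>i\<close> in the
  definition of \<open>H\<close>, first passage decompositions at \<open>j\<close> under the stationary law give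
  \<open>\<Sum>\<^sub>r\<^sub>\<le>\<^sub>n (p\<^sup>r\<^sub>i\<^sub>i - \<pi>\<^sub>i) \<ge> P\<^sub>\<pi>(X\<^sub>0, \<dots>, X\<^sub>n \<noteq> j) \<Sum>\<^sub>r\<^sub>\<le>\<^sub>n p\<^sup>r\<^sub>j\<^sub>i - O(1)\<close>. By stationarity the first factor decreases from
  \<open>n - 1\<close> to \<open>n\<close> by exactly \<open>\<pi>\<^sub>j P(T\<^sub>j\<^sub>j > n)\<close>, so it is at least of order \<open>n powr (1 - \<alpha>)\<close>, while the second one
  grows linearly. Hence the autocovariances sum to at least \<open>c n powr (2 - \<alpha>) - O(1)\<close>.

  Second, the distance to \<open>\<pi>\<close> is \<open>O(n powr -\<delta>)\<close> for every \<open>\<delta> < \<alpha> - 1\<close>. The weighted sequence space of all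
  \<open>a\<close> with \<open>\<Sum>\<^sub>n \<bar>a\<^sub>n\<bar> (1 + n) powr \<delta> < \<infinity>\<close> is a convolution algebra that contains the tail probabilities
  \<open>P(T\<^sub>j\<^sub>j > n)\<close>. Their generating function does not vanish on the closed unit disc, by aperiodicity, so it
  is invertible in this algebra by Wiener's lemma. This bounds \<open>p\<^sup>n\<^sub>j\<^sub>j - \<pi>\<^sub>j\<close>, and decomposing at the visits
  to \<open>j\<close> extends the bound to all starting states and all sets, uniformly in the set.
\<close>

section \<open>Wiener's lemma for weighted power series\<close>

text \<open>The shift by one gives index 0 the weight 1 and makes the weight
  submultiplicative.\<close>

definition weight :: "real \<Rightarrow> nat \<Rightarrow> real" where
  "weight \<delta> n = (1 + real n) powr \<delta>"

lemma weight_pos [simp]: "0 < weight \<delta> n"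
  by (simp add: weight_def)

lemma weight_nonneg [simp]: "0 \<le> weight \<delta> n"
  by (simp add: weight_def)

lemma weight_0 [simp]: "weight \<delta> 0 = 1"
  by (simp add: weight_def)

lemma weight_mono: "0 \<le> \<delta> \<Longrightarrow> m \<le> n \<Longrightarrow> weight \<delta> m \<le> weight \<delta> n"
  unfolding weight_def by (intro powr_mono2) auto

lemma one_le_weight: "0 \<le> \<delta> \<Longrightarrow> 1 \<le> weight \<delta> n"
  using weight_mono[of \<delta> 0 n] by simp

text \<open>Since \<open>1 + m + n\<close> is at most \<open>(1 + m) * (1 + n)\<close>. This is what
  turns the weighted sequences into a convolution algebra.\<close>

lemma weight_add_le:
  assumes "0 \<le> \<delta>"
  shows "weight \<delta> (m + n) \<le> weight \<delta> m * weight \<delta> n"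
proof -
  have "(1 + real (m + n)) powr \<delta> \<le> ((1 + real m) * (1 + real n)) powr \<delta>"
    using assms by (intro powr_mono2) (auto simp: algebra_simps)
  then show ?thesis
    by (simp add: weight_def powr_mult)
qed

text \<open>Truncation at \<open>N\<close> keeps the norm finite for every power series; a bound
  uniform in \<open>N\<close> amounts to membership in the weighted algebra.\<close>

definition wnorm :: "real \<Rightarrow> nat \<Rightarrow> 'a::real_normed_vector fps \<Rightarrow> real" where
  "wnorm \<delta> N A = (\<Sum>n\<le>N. norm (fps_nth A n) * weight \<delta> n)"

lemma wnorm_nonneg [simp]: "0 \<le> wnorm \<delta> N A"
  unfolding wnorm_def by (intro sum_nonneg) simp

lemma wnorm_sum_le: "wnorm \<delta> N (sum f I) \<le> (\<Sum>i\<in>I. wnorm \<delta> N (f i))"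
proof -
  have "wnorm \<delta> N (sum f I) \<le> (\<Sum>n\<le>N. \<Sum>i\<in>I. norm (fps_nth (f i) n) * weight \<delta> n)"
    unfolding wnorm_def fps_sum_nth sum_distrib_right[symmetric]
    by (intro sum_mono mult_right_mono norm_sum) simp
  also have "\<dots> = (\<Sum>i\<in>I. wnorm \<delta> N (f i))"
    unfolding wnorm_def by (rule sum.swap)
  finally show ?thesis .
qed

text \<open>Coefficients of the product up to \<open>N\<close> involve only coefficients of the
  factors up to \<open>N\<close>: the index triangle \<open>i + j \<le> N\<close> lies in a
  square.\<close>

lemma wnorm_mult_le:
  fixes A B :: "'a::real_normed_field fps"
  assumes "0 \<le> \<delta>"
  shows "wnorm \<delta> N (A * B) \<le> wnorm \<delta> N A * wnorm \<delta> N B"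
proof -
  let ?a = "\<lambda>n. norm (fps_nth A n) * weight \<delta> n" and ?b = "\<lambda>n. norm (fps_nth B n) * weight \<delta> n"
  have "norm (fps_nth (A * B) n) * weight \<delta> n \<le> (\<Sum>i\<le>n. ?a i * ?b (n - i))" for n
  proof -
    have "norm (fps_nth (A * B) n) * weight \<delta> n
        \<le> (\<Sum>i\<le>n. norm (fps_nth A i) * norm (fps_nth B (n - i))) * weight \<delta> n"
      unfolding fps_mult_nth atLeast0AtMost
      by (intro mult_right_mono sum_norm_le) (auto simp: norm_mult)
    also have "\<dots> \<le> (\<Sum>i\<le>n. ?a i * ?b (n - i))"
      unfolding sum_distrib_right
    proof (rule sum_mono)
      fix i assume "i \<in> {..n}"
      then have "weight \<delta> n \<le> weight \<delta> i * weight \<delta> (n - i)"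
        using weight_add_le[OF assms, of i "n - i"] by simp
      then have "(norm (fps_nth A i) * norm (fps_nth B (n - i))) * weight \<delta> n
          \<le> (norm (fps_nth A i) * norm (fps_nth B (n - i))) * (weight \<delta> i * weight \<delta> (n - i))"
        by (intro mult_left_mono) auto
      then show "norm (fps_nth A i) * norm (fps_nth B (n - i)) * weight \<delta> n \<le> ?a i * ?b (n - i)"
        by (simp add: mult_ac)
    qed
    finally show ?thesis .
  qed
  then have "wnorm \<delta> N (A * B) \<le> (\<Sum>n\<le>N. \<Sum>i\<le>n. ?a i * ?b (n - i))"
    unfolding wnorm_def by (intro sum_mono) auto
  also have "\<dots> = (\<Sum>(i, j)\<in>{(i, j). i + j \<le> N}. ?a i * ?b j)"
    by (rule sum.triangle_reindex_eq[symmetric])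
  also have "\<dots> \<le> (\<Sum>(i, j)\<in>{..N} \<times> {..N}. ?a i * ?b j)"
    by (intro sum_mono2) auto
  also have "\<dots> = wnorm \<delta> N A * wnorm \<delta> N B"
    unfolding wnorm_def sum_product sum.cartesian_product ..
  finally show ?thesis .
qed

lemma wnorm_power_le:
  fixes A :: "'a::real_normed_field fps"
  assumes "0 \<le> \<delta>"
  shows "wnorm \<delta> N (A ^ k) \<le> wnorm \<delta> N A ^ k"
proof (induction k)
  case 0
  have "wnorm \<delta> N (1 :: 'a fps) = (\<Sum>n\<le>N. if n = 0 then 1 else 0)"
    unfolding wnorm_def by (intro sum.cong) auto
  then show ?case
    by simp
next
  case (Suc k)
  then show ?case
    using wnorm_mult_le[OF assms, of N A "A ^ k"]
    by (simp add: mult_left_mono order_trans[OF _ mult_left_mono])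
qed

lemma summable_weight_geometric:
  assumes "1 < r"
  shows "summable (\<lambda>n. weight \<delta> n / r ^ n)"
proof -
  have "(\<lambda>n. weight \<delta> n / r ^ n) \<in> O(\<lambda>n. 1 / real n ^ 2)"
    unfolding weight_def using assms by real_asymp
  moreover have "summable (\<lambda>n. norm (1 / real n ^ 2))"
    using inverse_power_summable[of 2, where 'a=real] by (simp add: divide_inverse)
  ultimately show ?thesis
    by (rule summable_comparison_test_bigo[rotated])
qed

text \<open>Cauchy's estimate on the circle of radius \<open>r\<close>. The exponent
  \<open>k\<close> enters only through a geometric factor, and the decay in \<open>n\<close> is fast
  enough for any power weight.\<close>

lemma fps_nth_inverse_poly_power_bound:
  fixes p :: "complex poly"
  assumes "1 < r" and "0 < e" and lower: "\<And>z. norm z \<le> r \<Longrightarrow> e \<le> norm (poly p z)"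
  shows "norm (fps_nth (inverse (fps_of_poly p) ^ k) n) \<le> inverse e ^ k / r ^ n"
proof -
  let ?f = "\<lambda>z. inverse (poly p z) ^ k"
  have nz: "poly p z \<noteq> 0" if "norm z \<le> r" for z
    using lower[OF that] \<open>0 < e\<close> by auto
  have "coeff p 0 \<noteq> 0"
    using nz[of 0] \<open>1 < r\<close> by (simp add: poly_0_coeff_0)
  then have "?f has_fps_expansion inverse (fps_of_poly p) ^ k"
    by (intro has_fps_expansion_power has_fps_expansion_inverse)
      (auto simp: has_fps_expansion_def fps_conv_radius_fps_of_poly)
  then have "fps_nth (inverse (fps_of_poly p) ^ k) n = (deriv ^^ n) ?f 0 / fact n"
    by (rule fps_nth_fps_expansion)
  moreover have "norm ((deriv ^^ n) ?f 0) \<le> fact n * inverse e ^ k / r ^ n"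
  proof (rule Cauchy_inequality)
    show "?f holomorphic_on ball 0 r"
      using nz by (intro holomorphic_intros) auto
    show "continuous_on (cball 0 r) ?f"
      using nz by (intro continuous_intros) auto
    show "norm (?f z) \<le> inverse e ^ k" if "norm (0 - z) = r" for z
      using lower[of z] that \<open>0 < e\<close>
      by (auto simp: norm_power norm_inverse intro!: power_mono le_imp_inverse_le)
  qed (use \<open>1 < r\<close> in auto)
  ultimately have "norm (fps_nth (inverse (fps_of_poly p) ^ k) n)
      \<le> (fact n * inverse e ^ k / r ^ n) / fact n"
    by (simp only: norm_divide norm_fact divide_right_mono fact_ge_zero)
  then show ?thesis
    by simp
qed

text \<open>
  Write \<open>G = P + E\<close> with \<open>P\<close> a polynomial and \<open>E\<close> a tail of small weighted norm. Cauchy's estimates on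
  a disc of radius larger than 1 bound the norm of \<open>P\<^sup>-\<^sup>k\<close> by a constant times \<open>(2/e)\<^sup>k\<close>, where \<open>e\<close> is the
  minimum of \<open>\<bar>G\<bar>\<close> on the closed unit disc, so the Neumann series of \<open>1/(P + E)\<close> converges. As \<open>E\<close>
  has no constant term, its partial sums give the coefficients exactly and no limit of power
  series is needed.
\<close>

lemma weighted_wiener:
  fixes G :: "complex fps"
  assumes \<delta>: "0 \<le> \<delta>" and summ: "summable (\<lambda>n. norm (fps_nth G n) * weight \<delta> n)"
    and nonzero: "\<And>z. norm z \<le> 1 \<Longrightarrow> (\<Sum>n. fps_nth G n * z ^ n) \<noteq> 0"
  shows "summable (\<lambda>n. norm (fps_nth (inverse G) n) * weight \<delta> n)"
proof -
  let ?g = "\<lambda>n. norm (fps_nth G n) * weight \<delta> n"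
  have term_le: "norm (fps_nth G n * z ^ n) \<le> ?g n" if "norm z \<le> 1" for n z
  proof -
    have "norm z ^ n \<le> 1"
      using that by (simp add: power_le_one)
    then have "norm z ^ n \<le> weight \<delta> n"
      using one_le_weight[OF \<delta>, of n] by linarith
    then show ?thesis
      by (simp add: norm_mult norm_power mult_left_mono)
  qed
  have sz: "summable (\<lambda>n. norm (fps_nth G n * z ^ n))" if "norm z \<le> 1" for z
    using summ term_le[OF that] by (intro summable_comparison_test[OF _ summ]) auto
  define S where "S z = (\<Sum>n. fps_nth G n * z ^ n)" for z
  \<comment> \<open>By the M-test \<open>S\<close> is continuous on the closed disc, so its modulus
    attains a minimum \<open>e\<close> there, positive by \<open>nonzero\<close>.\<close>
  have "uniform_limit (cball 0 1) (\<lambda>N z. \<Sum>n<N. fps_nth G n * z ^ n) S sequentially"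
    unfolding S_def using term_le summ by (intro Weierstrass_m_test) auto
  then have "continuous_on (cball 0 1) S"
    by (rule uniform_limit_theorem[rotated]) (auto intro!: always_eventually continuous_intros)
  then obtain z0 where z0: "z0 \<in> cball 0 1" "\<And>z. z \<in> cball 0 1 \<Longrightarrow> norm (S z0) \<le> norm (S z)"
    using continuous_attains_inf[OF _ _ continuous_on_norm] by (metis cball_eq_empty compact_cball zero_le_one not_le)
  define e where "e = norm (S z0)"
  have "e > 0"
    using nonzero[of z0] z0(1) by (auto simp: e_def S_def)
  have S_lower: "e \<le> norm (S z)" if "norm z \<le> 1" for z
    using z0(2)[of z] that by (simp add: e_def)

  \<comment> \<open>A tail below \<open>e / 3\<close> leaves the polynomial at least
    \<open>2 * e / 3\<close> on the disc. Cutting at \<open>Suc M\<close> keeps the constant term in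
    the polynomial.\<close>
  obtain M where M: "(\<Sum>n. ?g (n + Suc M)) < e / 3"
  proof -
    have "(\<lambda>k. \<Sum>n. ?g (n + k)) \<longlonglongrightarrow> 0"
      using suminf_exist_split2[OF summ] .
    then have "eventually (\<lambda>k. (\<Sum>n. ?g (n + k)) < e / 3) sequentially"
      by (rule order_tendstoD) (use \<open>e > 0\<close> in auto)
    then obtain k where "\<And>m. m \<ge> k \<Longrightarrow> (\<Sum>n. ?g (n + m)) < e / 3"
      by (auto simp: eventually_sequentially)
    from this[of "Suc k"] that show ?thesis
      by auto
  qed
  define p where "p = truncate_fps (Suc M) G"
  define P where "P = fps_of_poly p"
  define E where "E = G - P"
  have P: "P = fps_cutoff (Suc M) G"
    by (simp add: P_def p_def)
  have E_nth: "fps_nth E n = (if n \<le> M then 0 else fps_nth G n)" for n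
    by (auto simp: E_def P)
  have E_wnorm: "wnorm \<delta> N E \<le> e / 3" for N
  proof -
    have "wnorm \<delta> N E \<le> (\<Sum>n\<in>{Suc M..<Suc M + Suc N}. ?g n)"
    proof -
      have "wnorm \<delta> N E = (\<Sum>n\<in>{n. n \<le> N \<and> M < n}. ?g n)"
        unfolding wnorm_def by (intro sum.mono_neutral_cong_right) (auto simp: E_nth)
      also have "\<dots> \<le> (\<Sum>n\<in>{Suc M..<Suc M + Suc N}. ?g n)"
        by (intro sum_mono2) auto
      finally show ?thesis .
    qed
    also have "\<dots> = (\<Sum>n<Suc N. ?g (n + Suc M))"
      using sum.shift_bounds_nat_ivl[of ?g 0 "Suc M" "Suc N"]
      by (simp add: atLeast0LessThan add.commute del: sum.lessThan_Suc sum.op_ivl_Suc)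
    also have "\<dots> \<le> (\<Sum>n. ?g (n + Suc M))"
      by (intro sum_le_suminf summable_ignore_initial_segment[OF summ]) auto
    finally show ?thesis
      using M by linarith
  qed
  have poly_p: "poly p z = (\<Sum>n<Suc M. fps_nth G n * z ^ n)" for z
  proof -
    have "eval_fps P z = (\<Sum>n<Suc M. fps_nth G n * z ^ n)"
      unfolding eval_fps_def P by (subst suminf_finite[of "{..<Suc M}"]) auto
    then show ?thesis
      by (simp add: P_def)
  qed
  have p_lower1: "2 * e / 3 \<le> norm (poly p z)" if z: "norm z \<le> 1" for z
  proof -
    have "S z = (\<Sum>n. fps_nth G (n + Suc M) * z ^ (n + Suc M)) + poly p z"
      unfolding S_def poly_p by (rule suminf_split_initial_segment[OF summable_norm_cancel[OF sz[OF z]]])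
    moreover have "norm (\<Sum>n. fps_nth G (n + Suc M) * z ^ (n + Suc M)) \<le> (\<Sum>n. ?g (n + Suc M))"
      using term_le[OF z] by (intro norm_suminf_le summable_ignore_initial_segment[OF summ])
    moreover have "norm (S z) \<le> norm (\<Sum>n. fps_nth G (n + Suc M) * z ^ (n + Suc M)) + norm (poly p z)"
      unfolding calculation(1) by (rule norm_triangle_ineq)
    ultimately show ?thesis
      using S_lower[OF z] M by linarith
  qed
  obtain r where r: "1 < r" "\<And>z. norm z \<le> r \<Longrightarrow> e / 2 \<le> norm (poly p z)"
  proof -
    \<comment> \<open>A point just outside the unit disc is compared with its radial projection to
      the unit circle; the allowed loss is \<open>2 * e / 3 - e / 2 = e / 6\<close>.\<close>
    have "uniformly_continuous_on (cball 0 2) (poly p)"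
      by (intro compact_uniformly_continuous continuous_intros) auto
    then obtain d where d: "d > 0"
      "\<And>x y. x \<in> cball 0 2 \<Longrightarrow> y \<in> cball 0 2 \<Longrightarrow> dist x y < d \<Longrightarrow> dist (poly p x) (poly p y) < e / 6"
      unfolding uniformly_continuous_on_def using \<open>e > 0\<close> by (metis divide_pos_pos zero_less_numeral)
    define r where "r = 1 + min (d / 2) 1"
    have "e / 2 \<le> norm (poly p z)" if z: "norm z \<le> r" for z
    proof (cases "norm z \<le> 1")
      case True
      then show ?thesis
        using p_lower1[of z] \<open>e > 0\<close> by simp
    next
      case False
      define y where "y = z / of_real (norm z)"
      have [simp]: "norm y = 1"
        using False by (auto simp: y_def norm_divide)
      have "of_real (norm z) * y = z"
        using False by (auto simp: y_def)
      then have "z - y = of_real (norm z - 1) * y"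
        by (simp add: left_diff_distrib)
      then have "dist z y = norm z - 1"
        using False by (simp add: dist_norm norm_mult del: of_real_diff)
      also have "\<dots> < d"
        using z d(1) by (auto simp: r_def)
      finally have "dist (poly p z) (poly p y) < e / 6"
        using z by (intro d(2)) (auto simp: r_def)
      moreover have "2 * e / 3 \<le> norm (poly p y)"
        by (intro p_lower1) simp
      ultimately show ?thesis
        using norm_triangle_ineq2[of "poly p y" "poly p z"]
        by (simp add: dist_norm norm_minus_commute)
    qed
    moreover have "1 < r"
      using d(1) by (simp add: r_def)
    ultimately show ?thesis
      using that by blast
  qed

  define C where "C = (\<Sum>n. weight \<delta> n / r ^ n)"
  have C_nonneg: "0 \<le> C"
    unfolding C_def using r(1) by (intro suminf_nonneg summable_weight_geometric) auto
  have invP: "wnorm \<delta> N (inverse P ^ k) \<le> (2 / e) ^ k * C" for N k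
  proof -
    have "wnorm \<delta> N (inverse P ^ k) \<le> (\<Sum>n\<le>N. (2 / e) ^ k * (weight \<delta> n / r ^ n))"
      unfolding wnorm_def
    proof (rule sum_mono)
      fix n
      have "norm (fps_nth (inverse P ^ k) n) \<le> (2 / e) ^ k / r ^ n"
        using fps_nth_inverse_poly_power_bound[OF r(1) _ r(2), of k n] \<open>e > 0\<close> by (simp add: P_def)
      then have "norm (fps_nth (inverse P ^ k) n) * weight \<delta> n \<le> ((2 / e) ^ k / r ^ n) * weight \<delta> n"
        by (rule mult_right_mono) simp
      then show "norm (fps_nth (inverse P ^ k) n) * weight \<delta> n \<le> (2 / e) ^ k * (weight \<delta> n / r ^ n)"
        by simp
    qed
    also have "\<dots> \<le> (2 / e) ^ k * C"
      unfolding C_def sum_distrib_left[symmetric] using r(1) \<open>e > 0\<close>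
      by (intro mult_left_mono sum_le_suminf summable_weight_geometric) auto
    finally show ?thesis .
  qed

  have G0: "fps_nth G 0 \<noteq> 0"
    using nonzero[of 0] powser_zero[of "fps_nth G"] by simp
  have P0: "fps_nth P 0 \<noteq> 0"
    using G0 by (simp add: P)
  \<comment> \<open>Chosen so that \<open>P * (1 - y) = G\<close>; its vanishing constant term makes
    the Neumann series finite in every coefficient.\<close>
  define y where "y = - E * inverse P"
  have y0: "fps_nth y 0 = 0"
    by (simp add: y_def E_nth)
  have neumann: "inverse G = inverse P * (\<Sum>k<K. y ^ k) + y ^ K * inverse G" for K
  proof -
    have "P * (1 - y) = G"
      using inverse_mult_eq_1[OF P0] by (simp add: y_def E_def algebra_simps)
    have "G * (inverse P * (\<Sum>k<K. y ^ k)) = (inverse P * P) * ((1 - y) * (\<Sum>k<K. y ^ k))"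
      unfolding \<open>P * (1 - y) = G\<close>[symmetric] by (simp add: mult_ac)
    also have "\<dots> = 1 - y ^ K"
      using inverse_mult_eq_1[OF P0] by (simp add: one_diff_power_eq)
    finally have "inverse G * (G * (inverse P * (\<Sum>k<K. y ^ k))) = inverse G * (1 - y ^ K)"
      by simp
    then have "inverse P * (\<Sum>k<K. y ^ k) = inverse G * (1 - y ^ K)"
      by (simp only: mult.assoc[symmetric] inverse_mult_eq_1[OF G0] mult_1_left)
    then show ?thesis
      by (simp add: right_diff_distrib mult.commute)
  qed
  have bound: "wnorm \<delta> N (inverse G) \<le> 6 * C / e" for N
  proof -
    \<comment> \<open>All terms of \<open>y ^ Suc N\<close> have index above \<open>N\<close>, so
      the Neumann remainder is invisible to \<open>wnorm \<delta> N\<close>.\<close>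
    have "fps_nth (y ^ Suc N * inverse G) n = 0" if "n \<le> N" for n
      unfolding fps_mult_nth
      using startsby_zero_power_prefix[OF y0, of "Suc N"] that by (intro sum.neutral) auto
    then have "wnorm \<delta> N (inverse G) = wnorm \<delta> N (inverse P * (\<Sum>k<Suc N. y ^ k))"
      unfolding wnorm_def by (subst neumann[of "Suc N"]) (intro sum.cong refl, simp)
    also have "inverse P * (\<Sum>k<Suc N. y ^ k) = (\<Sum>k<Suc N. (- E) ^ k * inverse P ^ Suc k)"
      unfolding sum_distrib_left y_def power_mult_distrib power_Suc
      by (intro sum.cong refl) (simp only: mult_ac)
    also have "wnorm \<delta> N \<dots> \<le> (\<Sum>k<Suc N. wnorm \<delta> N ((- E) ^ k * inverse P ^ Suc k))"
      by (rule wnorm_sum_le)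
    also have "\<dots> \<le> (\<Sum>k<Suc N. 2 * C / e * (2 / 3) ^ k)"
    proof (rule sum_mono)
      fix k
      have "wnorm \<delta> N ((- E) ^ k * inverse P ^ Suc k)
          \<le> wnorm \<delta> N ((- E) ^ k) * wnorm \<delta> N (inverse P ^ Suc k)"
        by (rule wnorm_mult_le[OF \<delta>])
      also have "\<dots> \<le> (e / 3) ^ k * ((2 / e) ^ Suc k * C)"
      proof (intro mult_mono invP)
        have "wnorm \<delta> N (- E) = wnorm \<delta> N E"
          by (simp add: wnorm_def)
        then have "wnorm \<delta> N (- E) ^ k \<le> (e / 3) ^ k"
          using E_wnorm[of N] by (intro power_mono) auto
        then show "wnorm \<delta> N ((- E) ^ k) \<le> (e / 3) ^ k"
          using wnorm_power_le[OF \<delta>, of N "- E" k] by linarith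
      qed (use \<open>e > 0\<close> in auto)
      \<comment> \<open>The factors \<open>e / 3\<close> and \<open>2 / e\<close> combine to the
        ratio \<open>2 / 3\<close>, so the geometric series sums to \<open>6 * C / e\<close> for
        every \<open>N\<close>.\<close>
      also have "\<dots> = 2 * C / e * (2 / 3) ^ k"
        using \<open>e > 0\<close> by (simp add: power_divide mult_ac)
      finally show "wnorm \<delta> N ((- E) ^ k * inverse P ^ Suc k) \<le> 2 * C / e * (2 / 3) ^ k" .
    qed
    also have "\<dots> \<le> (\<Sum>k. 2 * C / e * (2 / 3) ^ k)"
      using C_nonneg \<open>e > 0\<close> by (intro sum_le_suminf summable_mult summable_geometric) auto
    also have "\<dots> = 6 * C / e"
      by (subst suminf_mult) (auto simp: suminf_geometric summable_geometric)
    finally show ?thesis .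
  qed
  show ?thesis
  proof (rule summableI_nonneg_bounded)
    show "(\<Sum>i<n. norm (fps_nth (inverse G) i) * weight \<delta> i) \<le> 6 * C / e" for n
    proof -
      have "(\<Sum>i<n. norm (fps_nth (inverse G) i) * weight \<delta> i) \<le> wnorm \<delta> n (inverse G)"
        unfolding wnorm_def by (intro sum_mono2) auto
      then show ?thesis
        using bound[of n] by linarith
    qed
  qed simp
qed

section \<open>Finite-dimensional distributions\<close>

text \<open>The recursion peels off the first step, as the first passage arguments do.\<close>

primrec step_pmf :: "('s \<Rightarrow> 's pmf) \<Rightarrow> nat \<Rightarrow> 's \<Rightarrow> 's pmf" where
  "step_pmf K 0 i = return_pmf i"
| "step_pmf K (Suc n) i = bind_pmf (K i) (step_pmf K n)"

primrec path_pmf :: "('s \<Rightarrow> 's pmf) \<Rightarrow> nat \<Rightarrow> 's pmf \<Rightarrow> 's list pmf" where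
  "path_pmf K 0 \<mu> = map_pmf (\<lambda>x. [x]) \<mu>"
| "path_pmf K (Suc n) \<mu> = bind_pmf \<mu> (\<lambda>x. map_pmf ((#) x) (path_pmf K n (K x)))"

section \<open>Integrals of functions with values in the unit interval\<close>

lemma integrable_unit_interval:
  fixes g :: "'a \<Rightarrow> real"
  assumes "range g \<subseteq> {0..1}"
  shows "integrable (measure_pmf p) g"
proof (rule measure_pmf.integrable_const_bound)
  have "norm (g x) \<le> 1" for x
    using range_subsetD[OF assms, of x] by simp
  then show "AE x in measure_pmf p. norm (g x) \<le> 1"
    by simp
qed simp

lemma integral_unit_interval:
  fixes g :: "'a \<Rightarrow> real"
  assumes "range g \<subseteq> {0..1}"
  shows "(\<integral>x. g x \<partial>measure_pmf p) \<in> {0..1}"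
proof -
  have "0 \<le> (\<integral>x. g x \<partial>measure_pmf p)"
    using range_subsetD[OF assms] by (intro integral_nonneg_AE) auto
  moreover have "(\<integral>x. g x \<partial>measure_pmf p) \<le> 1"
    using range_subsetD[OF assms] by (intro measure_pmf.integral_le_const integrable_unit_interval[OF assms]) auto
  ultimately show ?thesis
    by simp
qed

lemma integral_bind_pmf:
  fixes g :: "'b \<Rightarrow> real"
  assumes "range g \<subseteq> {0..1}"
  shows "(\<integral>x. g x \<partial>measure_pmf (bind_pmf p f)) = (\<integral>x. (\<integral>y. g y \<partial>measure_pmf (f x)) \<partial>measure_pmf p)"
proof -
  have nonneg: "0 \<le> g x" for x
    using range_subsetD[OF assms, of x] by simp
  have "ennreal (\<integral>x. g x \<partial>measure_pmf (bind_pmf p f)) = (\<integral>\<^sup>+x. g x \<partial>measure_pmf (bind_pmf p f))"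
    using nonneg by (intro nn_integral_eq_integral[symmetric] integrable_unit_interval[OF assms]) auto
  also have "\<dots> = (\<integral>\<^sup>+x. ennreal (\<integral>y. g y \<partial>measure_pmf (f x)) \<partial>measure_pmf p)"
    unfolding nn_integral_bind_pmf using nonneg
    by (intro nn_integral_cong nn_integral_eq_integral integrable_unit_interval[OF assms]) auto
  also have "\<dots> = ennreal (\<integral>x. (\<integral>y. g y \<partial>measure_pmf (f x)) \<partial>measure_pmf p)"
    using integral_unit_interval[OF assms]
    by (intro nn_integral_eq_integral integrable_unit_interval) (auto simp: image_subset_iff)
  finally show ?thesis
    using nonneg by (subst (asm) ennreal_inj) (auto intro!: integral_nonneg_AE)
qed

lemma measure_bind_pmf:
  "measure (measure_pmf (bind_pmf p f)) A = (\<integral>x. measure (measure_pmf (f x)) A \<partial>measure_pmf p)"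
proof -
  have "range (indicat_real A) \<subseteq> {0..1}"
    by (auto simp: indicator_def)
  from integral_bind_pmf[OF this, of p f] show ?thesis
    by simp
qed

lemma set_path_pmf: "xs \<in> set_pmf (path_pmf K n \<mu>) \<Longrightarrow> length xs = Suc n"
  by (induction n arbitrary: xs \<mu>) auto

lemma pmf_path_pmf_Cons:
  "pmf (path_pmf K (Suc n) \<mu>) (x # xs) = pmf \<mu> x * pmf (path_pmf K n (K x)) xs"
proof -
  have "pmf (map_pmf ((#) y) (path_pmf K n (K y))) (x # xs)
      = indicator {x} y * pmf (path_pmf K n (K x)) xs" for y
    by (cases "y = x") (simp add: pmf_map_inj', subst pmf_map_outside, auto)
  then show ?thesis
    by (simp add: pmf_bind measure_pmf_single)
qed

lemma pmf_path_pmf: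
  "pmf (path_pmf K n \<mu>) (map x [0..<Suc n]) = pmf \<mu> (x 0) * (\<Prod>k<n. pmf (K (x k)) (x (Suc k)))"
proof (induction n arbitrary: \<mu> x)
  case 0
  have "inj (\<lambda>x :: 'a. [x])"
    by (simp add: inj_def)
  then show ?case
    using pmf_map_inj'[of "\<lambda>x. [x]" \<mu> "x 0"] by simp
next
  case (Suc n)
  have "map x [0..<Suc (Suc n)] = x 0 # map (\<lambda>k. x (Suc k)) [0..<Suc n]"
    by (simp only: upt_conv_Cons[OF zero_less_Suc] map_Suc_upt[symmetric] list.map map_map comp_def)
  then show ?case
    by (simp only: pmf_path_pmf_Cons Suc.IH prod.lessThan_Suc_shift mult.assoc)
qed

section \<open>Reduction of the path space measure to discrete path laws\<close>

lemma map_upt_eq_iff: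
  "map \<omega> [0..<Suc n] = xs \<longleftrightarrow> length xs = Suc n \<and> (\<forall>k\<le>n. \<omega> k = xs ! k)"
  by (auto simp: list_eq_iff_nth_eq less_Suc_eq_le simp del: upt_Suc)

lemma measurable_chain_coord [measurable]:
  "(\<lambda>\<omega>. \<omega> k) \<in> chain_law K \<mu> \<rightarrow>\<^sub>M count_space (UNIV :: 's::countable set)"
proof -
  have "(\<lambda>\<omega>. \<omega> k) \<in> PiM UNIV (\<lambda>_. count_space (UNIV :: 's set)) \<rightarrow>\<^sub>M count_space UNIV"
    by (rule measurable_component_singleton) simp
  then show ?thesis
    by (simp cong: measurable_cong_sets add: sets_chain_law)
qed

lemma measurable_chain_path [measurable]:
  "(\<lambda>\<omega>. map \<omega> [0..<Suc n]) \<in> chain_law K \<mu> \<rightarrow>\<^sub>M count_space (UNIV :: 's::countable list set)"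
proof -
  have "(\<lambda>\<omega>. map \<omega> [0..<Suc n]) -` {xs} \<inter> space (chain_law K \<mu>) \<in> sets (chain_law K \<mu>)" for xs :: "'s list"
  proof -
    have "{\<omega> \<in> space (chain_law K \<mu>). length xs = Suc n \<and> (\<forall>k\<le>n. \<omega> k = xs ! k)} \<in> sets (chain_law K \<mu>)"
      by measurable
    then show ?thesis
      by (simp add: map_upt_eq_iff vimage_def del: upt_Suc)
  qed
  then show ?thesis
    by (subst measurable_count_space_eq2_countable) auto
qed

text \<open>The space of lists is countable, so singletons suffice: lists of length
  \<open>n + 1\<close> are handled by \<open>chain_law_fdd\<close>, and all others are null on both
  sides.\<close>

lemma distr_chain_path:
  "distr (chain_law K \<mu>) (count_space UNIV) (\<lambda>\<omega>. map \<omega> [0..<Suc n]) = measure_pmf (path_pmf K n \<mu>)"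
proof (rule measure_eqI_countable[where A = UNIV])
  interpret prob_space "chain_law K \<mu>"
    by (rule prob_space_chain_law)
  fix xs :: "'a list"
  have *: "emeasure (distr (chain_law K \<mu>) (count_space UNIV) (\<lambda>\<omega>. map \<omega> [0..<Suc n])) {xs}
      = ennreal (prob {\<omega>. length xs = Suc n \<and> (\<forall>k\<le>n. \<omega> k = xs ! k)})"
    by (subst emeasure_distr) (auto simp: emeasure_eq_measure map_upt_eq_iff vimage_def simp del: upt_Suc)
  show "emeasure (distr (chain_law K \<mu>) (count_space UNIV) (\<lambda>\<omega>. map \<omega> [0..<Suc n])) {xs}
      = emeasure (measure_pmf (path_pmf K n \<mu>)) {xs}"
  proof (cases "length xs = Suc n")
    case True
    then have xs: "map (\<lambda>k. xs ! k) [0..<Suc n] = xs"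
      using map_nth[of xs] by simp
    show ?thesis
      unfolding * emeasure_pmf_single
      using chain_law_fdd[of K \<mu> n "\<lambda>k. xs ! k"] pmf_path_pmf[of K n \<mu> "\<lambda>k. xs ! k"]
      by (simp add: True xs del: upt_Suc)
  next
    case False
    then have "xs \<notin> set_pmf (path_pmf K n \<mu>)"
      using set_path_pmf by blast
    then show ?thesis
      unfolding * emeasure_pmf_single using False by (simp add: pmf_eq_0_set_pmf)
  qed
qed auto

lemma measure_chain_law_path:
  "measure (chain_law K \<mu>) {\<omega>. Q (map \<omega> [0..<Suc n])} = measure (measure_pmf (path_pmf K n \<mu>)) {xs. Q xs}"
  unfolding distr_chain_path[symmetric] by (subst measure_distr) (auto simp: vimage_def simp del: upt_Suc)

lemma map_path_pmf_last: "map_pmf (\<lambda>xs. xs ! n) (path_pmf K n \<mu>) = bind_pmf \<mu> (step_pmf K n)"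
proof (induction n arbitrary: \<mu>)
  case 0
  show ?case
    by (simp add: pmf.map_comp comp_def bind_return_pmf')
next
  case (Suc n)
  have "map_pmf (\<lambda>xs. xs ! Suc n) (path_pmf K (Suc n) \<mu>)
      = bind_pmf \<mu> (\<lambda>x. map_pmf (\<lambda>xs. xs ! n) (path_pmf K n (K x)))"
    by (simp add: map_bind_pmf pmf.map_comp comp_def)
  then show ?case
    by (simp add: Suc.IH)
qed

lemma nstep_eq_step_pmf: "nstep K n i = measure_pmf (step_pmf K n i)"
proof -
  have "nstep K n i = distr (chain_law K (return_pmf i)) (count_space UNIV)
      (\<lambda>\<omega>. (\<lambda>xs. xs ! n) (map \<omega> [0..<Suc n]))"
    unfolding nstep_def by (simp del: upt_Suc)
  also have "\<dots> = distr (distr (chain_law K (return_pmf i)) (count_space UNIV) (\<lambda>\<omega>. map \<omega> [0..<Suc n]))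
      (count_space UNIV) (\<lambda>xs. xs ! n)"
    by (subst distr_distr) (auto simp: comp_def simp del: upt_Suc)
  also have "\<dots> = measure_pmf (map_pmf (\<lambda>xs. xs ! n) (path_pmf K n (return_pmf i)))"
    unfolding distr_chain_path map_pmf_rep_eq ..
  finally show ?thesis
    by (simp add: map_path_pmf_last bind_return_pmf)
qed

lemma measure_path_pmf_last:
  "measure (measure_pmf (path_pmf K n \<mu>)) {xs. xs ! n \<in> A} = (\<integral>x. measure (measure_pmf (step_pmf K n x)) A \<partial>measure_pmf \<mu>)"
proof -
  have "measure (measure_pmf (path_pmf K n \<mu>)) {xs. xs ! n \<in> A}
      = measure (measure_pmf (map_pmf (\<lambda>xs. xs ! n) (path_pmf K n \<mu>))) A"
    by (simp add: vimage_def)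
  then show ?thesis
    unfolding map_path_pmf_last measure_bind_pmf .
qed

lemma measure_path_pmf_Suc:
  "measure (measure_pmf (path_pmf K (Suc n) \<mu>)) A
     = (\<integral>x. measure (measure_pmf (path_pmf K n (K x))) {xs. x # xs \<in> A} \<partial>measure_pmf \<mu>)"
  by (simp add: measure_bind_pmf vimage_def)

text \<open>Supplies the mixed moment of the visit indicators at times 0 and
  \<open>n\<close>.\<close>

lemma measure_path_pmf_first_last:
  "measure (measure_pmf (path_pmf K n \<mu>)) {xs. xs ! 0 = i \<and> xs ! n \<in> A}
     = pmf \<mu> i * measure (measure_pmf (step_pmf K n i)) A"
proof (cases n)
  case 0
  have "{x. x = i \<and> x \<in> A} = (if i \<in> A then {i} else {})"
    by auto
  then show ?thesis
    by (simp add: 0 vimage_def pmf.rep_eq)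
next
  case (Suc m)
  have "measure (measure_pmf (path_pmf K m (K x))) {xs. x = i \<and> xs ! m \<in> A}
      = indicator {i} x * measure (measure_pmf (step_pmf K n i)) A" for x
    using measure_path_pmf_last[of K m "K x" A]
    by (auto simp: indicator_def Suc measure_bind_pmf)
  then show ?thesis
    unfolding Suc measure_path_pmf_Suc by (simp add: Suc pmf.rep_eq)
qed

section \<open>Taboo probabilities\<close>

text \<open>The substochastic operator of the chain killed on entering \<open>j\<close>, acting on
  functions of the starting state.\<close>

definition killed :: "('s \<Rightarrow> 's pmf) \<Rightarrow> 's \<Rightarrow> ('s \<Rightarrow> real) \<Rightarrow> 's \<Rightarrow> real" where
  "killed K j g i = (\<integral>k. indicator (- {j}) k * g k \<partial>measure_pmf (K i))"

text \<open>
  \<open>taboo K j A n i\<close> is the probability, from \<open>i\<close>, of being in \<open>A\<close> at time \<open>n\<close> without a visit to \<open>j\<close>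
  at the times \<open>1, \<dots>, n\<close> (time 0 is not restricted); \<open>hit K j n i\<close> is the probability that the first
  such visit occurs at time \<open>n + 1\<close>.
\<close>

definition taboo :: "('s \<Rightarrow> 's pmf) \<Rightarrow> 's \<Rightarrow> 's set \<Rightarrow> nat \<Rightarrow> 's \<Rightarrow> real" where
  "taboo K j A n = (killed K j ^^ n) (indicator A)"

abbreviation survival :: "('s \<Rightarrow> 's pmf) \<Rightarrow> 's \<Rightarrow> nat \<Rightarrow> 's \<Rightarrow> real" where
  "survival K j \<equiv> taboo K j UNIV"

definition hit :: "('s \<Rightarrow> 's pmf) \<Rightarrow> 's \<Rightarrow> nat \<Rightarrow> 's \<Rightarrow> real" where
  "hit K j n = (killed K j ^^ n) (\<lambda>i. pmf (K i) j)"

lemma unit_interval_restrict: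
  fixes g :: "'s \<Rightarrow> real"
  assumes "range g \<subseteq> {0..1}"
  shows "range (\<lambda>k. indicator A k * g k) \<subseteq> {0..1}"
  using assms by (auto simp: indicator_def image_subset_iff)

lemma killed_unit_interval: "range g \<subseteq> {0..1} \<Longrightarrow> range (killed K j g) \<subseteq> {0..1}"
  unfolding killed_def using integral_unit_interval[OF unit_interval_restrict] by fast

lemma funpow_killed_unit_interval: "range g \<subseteq> {0..1} \<Longrightarrow> range ((killed K j ^^ n) g) \<subseteq> {0..1}"
  by (induction n) (simp_all add: killed_unit_interval)

lemma taboo_unit_interval: "range (taboo K j A n) \<subseteq> {0..1}"
  unfolding taboo_def by (rule funpow_killed_unit_interval) (auto simp: indicator_def)

lemma hit_unit_interval: "range (hit K j n) \<subseteq> {0..1}"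
  unfolding hit_def by (rule funpow_killed_unit_interval) (auto simp: pmf_le_1)

lemma taboo_nonneg [simp]: "0 \<le> taboo K j A n i" and taboo_le_1 [simp]: "taboo K j A n i \<le> 1"
  using range_subsetD[OF taboo_unit_interval[of K j A n], of i] by auto

lemma hit_nonneg [simp]: "0 \<le> hit K j n i" and hit_le_1 [simp]: "hit K j n i \<le> 1"
  using range_subsetD[OF hit_unit_interval[of K j n], of i] by auto

lemma integrable_restrict_unit:
  fixes g :: "'s \<Rightarrow> real"
  shows "range g \<subseteq> {0..1} \<Longrightarrow> integrable (measure_pmf p) (\<lambda>k. indicator A k * g k)"
  by (intro integrable_unit_interval unit_interval_restrict)

lemma taboo_0 [simp]: "taboo K j A 0 i = indicator A i"
  by (simp add: taboo_def)

lemma taboo_Suc: "taboo K j A (Suc n) i = (\<integral>k. indicator (- {j}) k * taboo K j A n k \<partial>measure_pmf (K i))"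
  by (simp add: taboo_def killed_def)

lemma hit_0 [simp]: "hit K j 0 i = pmf (K i) j"
  by (simp add: hit_def)

lemma hit_Suc: "hit K j (Suc n) i = (\<integral>k. indicator (- {j}) k * hit K j n k \<partial>measure_pmf (K i))"
  by (simp add: hit_def killed_def)

lemma taboo_mono:
  assumes "A \<subseteq> B"
  shows "taboo K j A n i \<le> taboo K j B n i"
proof (induction n arbitrary: i)
  case (Suc n)
  show ?case
    unfolding taboo_Suc using Suc.IH
    by (intro integral_mono integrable_restrict_unit taboo_unit_interval mult_left_mono) auto
qed (use assms in \<open>auto simp: indicator_def\<close>)

lemma taboo_self: "0 < n \<Longrightarrow> taboo K j {j} n i = 0"
proof (induction n arbitrary: i)
  case (Suc n)
  have "indicator (- {j}) k * taboo K j {j} n k = 0" for k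
    using Suc.IH by (cases "n = 0") (auto simp: indicator_def)
  then show ?case
    by (simp only: taboo_Suc integral_zero)
qed simp

text \<open>Splits a step according to whether it lands on \<open>j\<close>; the recursions for
  survival, first passage and avoidance rest on it.\<close>

lemma integral_indicator_Compl_singleton:
  fixes g :: "'s \<Rightarrow> real"
  assumes "range g \<subseteq> {0..1}"
  shows "(\<integral>k. g k \<partial>measure_pmf p) = (\<integral>k. indicator (- {j}) k * g k \<partial>measure_pmf p) + pmf p j * g j"
proof -
  have "(\<integral>k. g k \<partial>measure_pmf p) = (\<integral>k. indicator (- {j}) k * g k + indicator {j} k * g j \<partial>measure_pmf p)"
    by (intro Bochner_Integration.integral_cong) (auto simp: indicator_def)
  also have "\<dots> = (\<integral>k. indicator (- {j}) k * g k \<partial>measure_pmf p) + (\<integral>k. indicator {j} k * g j \<partial>measure_pmf p)"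
    by (intro Bochner_Integration.integral_add integrable_restrict_unit assms integrable_mult_left)
      (use range_subsetD[OF assms, of j] in auto)
  finally show ?thesis
    by (simp add: pmf.rep_eq)
qed

text \<open>After surviving up to time \<open>n\<close>, the chain either avoids \<open>j\<close> at
  time \<open>n + 1\<close> or has its first hit exactly then.\<close>

lemma survival_Suc: "survival K j (Suc n) i = survival K j n i - hit K j n i"
proof (induction n arbitrary: i)
  case 0
  show ?case
    using integral_indicator_Compl_singleton[of "\<lambda>_. 1" "K i" j] by (simp add: taboo_Suc)
next
  case (Suc n)
  have "survival K j (Suc (Suc n)) i
      = (\<integral>k. indicator (- {j}) k * survival K j n k - indicator (- {j}) k * hit K j n k \<partial>measure_pmf (K i))"
    unfolding taboo_Suc[of _ _ _ "Suc n"] Suc.IH by (simp add: right_diff_distrib)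
  also have "\<dots> = survival K j (Suc n) i - hit K j (Suc n) i"
    unfolding taboo_Suc hit_Suc
    by (intro Bochner_Integration.integral_diff integrable_restrict_unit taboo_unit_interval hit_unit_interval)
  finally show ?case .
qed

lemma sum_hit: "(\<Sum>s<n. hit K j s i) = 1 - survival K j n i"
  by (induction n) (auto simp: survival_Suc)

lemma decseq_survival: "decseq (\<lambda>n. survival K j n i)"
  by (rule decseq_SucI) (simp add: survival_Suc)

text \<open>The Markov property as an inequality: only the paths at \<open>m\<close> at time
  \<open>n\<close> are kept. Survival and hitting probabilities as \<open>g\<close> give the next
  two comparisons.\<close>

lemma funpow_killed_ge:
  assumes "range g \<subseteq> {0..1}"
  shows "taboo K j {m} n i * g m \<le> (killed K j ^^ n) g i"
proof (induction n arbitrary: i)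
  case 0
  then show ?case
    using range_subsetD[OF assms, of i] by (auto simp: indicator_def)
next
  case (Suc n)
  have "taboo K j {m} (Suc n) i * g m
      = (\<integral>k. (indicator (- {j}) k * taboo K j {m} n k) * g m \<partial>measure_pmf (K i))"
    unfolding taboo_Suc by simp
  also have "\<dots> \<le> killed K j ((killed K j ^^ n) g) i"
    unfolding killed_def[of K j "(killed K j ^^ n) g"] mult.assoc using Suc.IH
    by (intro integral_mono mult_left_mono
        integrable_restrict_unit[OF funpow_killed_unit_interval[OF assms]])
      (simp_all add: mult.assoc[symmetric] integrable_restrict_unit[OF taboo_unit_interval])
  finally show ?case
    by simp
qed

lemma taboo_mult_survival_le: "taboo K j {m} n i * survival K j l m \<le> survival K j (n + l) i"
  using funpow_killed_ge[OF taboo_unit_interval, of K j m n i K j UNIV l]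
  by (simp add: taboo_def funpow_add)

lemma taboo_mult_hit_le: "taboo K j {m} n i * hit K j l m \<le> hit K j (n + l) i"
  using funpow_killed_ge[OF hit_unit_interval, of K j m n i K j l]
  by (simp add: hit_def funpow_add)

text \<open>Either \<open>j\<close> is not visited by time \<open>n\<close>, or its first visit is
  at time \<open>s + 1\<close> and the chain restarts from \<open>j\<close> with
  \<open>n - Suc s\<close> steps left.\<close>

lemma first_passage:
  "measure (measure_pmf (step_pmf K n i)) A
     = taboo K j A n i + (\<Sum>s<n. hit K j s i * measure (measure_pmf (step_pmf K (n - Suc s) j)) A)"
proof (induction n arbitrary: i)
  case (Suc n)
  let ?P = "\<lambda>n i. measure (measure_pmf (step_pmf K n i)) A"
  let ?I = "indicator (- {j}) :: 'a \<Rightarrow> real"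
  have unit: "range (?P n) \<subseteq> {0..1}" for n
    by auto
  have "?P (Suc n) i = (\<integral>k. ?I k * ?P n k \<partial>measure_pmf (K i)) + hit K j 0 i * ?P n j"
    using integral_indicator_Compl_singleton[OF unit[of n], of "K i" j] by (simp add: measure_bind_pmf)
  also have "(\<integral>k. ?I k * ?P n k \<partial>measure_pmf (K i))
      = (\<integral>k. ?I k * taboo K j A n k + (\<Sum>s<n. (?I k * hit K j s k) * ?P (n - Suc s) j) \<partial>measure_pmf (K i))"
    by (subst Suc.IH) (simp add: distrib_left sum_distrib_left mult.assoc)
  also have "\<dots> = taboo K j A (Suc n) i + (\<Sum>s<n. hit K j (Suc s) i * ?P (n - Suc s) j)"
    unfolding taboo_Suc hit_Suc
    by (subst Bochner_Integration.integral_add, intro integrable_restrict_unit taboo_unit_interval,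
        intro Bochner_Integration.integrable_sum integrable_mult_left integrable_restrict_unit hit_unit_interval)
      (simp add: integrable_restrict_unit hit_unit_interval)
  finally show ?case
    by (simp add: sum.lessThan_Suc_shift del: sum.lessThan_Suc)
qed simp

lemma return_time_gt_iff: "enat n < return_time j \<omega> \<longleftrightarrow> (\<forall>k\<in>{1..n}. \<omega> k \<noteq> j)"
proof -
  have "enat n < return_time j \<omega> \<longleftrightarrow> enat (Suc n) \<le> return_time j \<omega>"
    by (simp add: Suc_ile_eq)
  \<comment> \<open>A path that never returns is covered: the infimum of the empty set is
    \<infinity>.\<close>
  also have "\<dots> \<longleftrightarrow> (\<forall>k\<ge>1. \<omega> k = j \<longrightarrow> Suc n \<le> k)"
    unfolding return_time_def by (auto simp: le_Inf_iff)
  also have "\<dots> \<longleftrightarrow> (\<forall>k\<in>{1..n}. \<omega> k \<noteq> j)"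
    by (metis atLeastAtMost_iff not_less_eq_eq)
  finally show ?thesis .
qed

text \<open>Since \<open>survival\<close> leaves time 0 free, the condition at time 0 appears as a
  separate indicator.\<close>

lemma measure_path_pmf_avoid:
  "measure (measure_pmf (path_pmf K n \<mu>)) {xs. \<forall>k\<le>n. xs ! k \<noteq> j}
     = (\<integral>x. indicator (- {j}) x * survival K j n x \<partial>measure_pmf \<mu>)"
proof (induction n arbitrary: \<mu>)
  case 0
  have "{x. x \<noteq> j} = - {j}"
    by auto
  then show ?case
    by (simp add: vimage_def)
next
  case (Suc n)
  have split: "(\<forall>k\<le>Suc n. (x # xs) ! k \<noteq> j) \<longleftrightarrow> x \<noteq> j \<and> (\<forall>k\<le>n. xs ! k \<noteq> j)" for x xs
    using All_less_Suc2[of "Suc n" "\<lambda>k. (x # xs) ! k \<noteq> j"]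
    by (simp only: less_Suc_eq_le nth_Cons_Suc nth_Cons_0)
  have "measure (measure_pmf (path_pmf K n (K x))) {xs. x \<noteq> j \<and> (\<forall>k\<le>n. xs ! k \<noteq> j)}
      = indicator (- {j}) x * survival K j (Suc n) x" for x
    using Suc.IH[of "K x"] by (auto simp: indicator_def taboo_Suc)
  then show ?case
    unfolding measure_path_pmf_Suc mem_Collect_eq split by simp
qed

text \<open>Neither side restricts time 0, so the start at \<open>j\<close> is included and the tail
  hypothesis becomes one on \<open>survival\<close>.\<close>

lemma measure_return_time_gt:
  "measure (chain_law K (return_pmf i)) {\<omega>. enat n < return_time j \<omega>} = survival K j n i"
proof -
  have "{\<omega>. enat n < return_time j \<omega>} = {\<omega>. \<forall>k\<in>{1..n}. map \<omega> [0..<Suc n] ! k \<noteq> j}"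
    by (auto simp: return_time_gt_iff simp del: upt_Suc)
  then have "measure (chain_law K (return_pmf i)) {\<omega>. enat n < return_time j \<omega>}
      = measure (measure_pmf (path_pmf K n (return_pmf i))) {xs. \<forall>k\<in>{1..n}. xs ! k \<noteq> j}"
    by (simp only: measure_chain_law_path[of K "return_pmf i" "\<lambda>xs. \<forall>k\<in>{1..n}. xs ! k \<noteq> j" n])
  also have "\<dots> = survival K j n i"
  proof (cases n)
    case (Suc m)
    have *: "{1..Suc m} = Suc ` {..m}"
      by (simp add: image_Suc_atMost)
    have "(\<forall>k\<in>{1..Suc m}. (i # xs) ! k \<noteq> j) \<longleftrightarrow> (\<forall>k\<le>m. xs ! k \<noteq> j)" for xs
      unfolding * by (auto simp del: image_Suc_atMost)
    then show ?thesis
      using measure_path_pmf_avoid[of K m "K i" j]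
      by (simp add: Suc measure_path_pmf_Suc taboo_Suc del: path_pmf.simps)
  qed simp
  finally show ?thesis .
qed

section \<open>The renewal theorem with a rate\<close>

text \<open>Submultiplicativity, read as \<open>1 / weight \<delta> (n - m) \<le> weight \<delta> m
  / weight \<delta> n\<close>, moves the weight from \<open>b\<close> to the summable factor
  \<open>q\<close>.\<close>

lemma convolution_decay:
  fixes q b :: "nat \<Rightarrow> 'a::real_normed_field"
  assumes \<delta>: "0 \<le> \<delta>" and q: "summable (\<lambda>m. norm (q m) * weight \<delta> m)"
    and b: "\<And>m. norm (b m) \<le> B / weight \<delta> m"
  shows "norm (\<Sum>m\<le>n. q m * b (n - m)) \<le> (\<Sum>m. norm (q m) * weight \<delta> m) * B / weight \<delta> n"
proof -
  have "0 \<le> B / weight \<delta> 0"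
    using b[of 0] norm_ge_zero order_trans by blast
  then have B: "0 \<le> B"
    by simp
  have "norm (\<Sum>m\<le>n. q m * b (n - m)) \<le> (\<Sum>m\<le>n. norm (q m) * weight \<delta> m * (B / weight \<delta> n))"
  proof (rule sum_norm_le)
    fix m assume "m \<in> {..n}"
    then have "weight \<delta> n \<le> weight \<delta> m * weight \<delta> (n - m)"
      using weight_add_le[OF \<delta>, of m "n - m"] by simp
    then have "B / weight \<delta> (n - m) \<le> weight \<delta> m * (B / weight \<delta> n)"
      using B mult_right_mono[of "weight \<delta> n" "weight \<delta> m * weight \<delta> (n - m)" B]
      by (simp add: field_simps)
    then have "norm (b (n - m)) \<le> weight \<delta> m * (B / weight \<delta> n)"
      using b[of "n - m"] by linarith
    then show "norm (q m * b (n - m)) \<le> norm (q m) * weight \<delta> m * (B / weight \<delta> n)"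
      unfolding norm_mult mult.assoc by (rule mult_left_mono) simp
  qed
  also have "\<dots> = (\<Sum>m\<le>n. norm (q m) * weight \<delta> m) * (B / weight \<delta> n)"
    by (simp only: sum_distrib_right)
  also have "\<dots> \<le> (\<Sum>m. norm (q m) * weight \<delta> m) * (B / weight \<delta> n)"
    using B by (intro mult_right_mono sum_le_suminf q) auto
  finally show ?thesis
    by simp
qed

text \<open>As in Markov's inequality: every index in the tail has weight at least
  \<open>weight \<delta> n\<close>.\<close>

lemma weighted_tail_le:
  fixes t :: "nat \<Rightarrow> real"
  assumes \<delta>: "0 \<le> \<delta>" and t: "\<And>n. 0 \<le> t n" and summ: "summable (\<lambda>n. t n * weight \<delta> n)"
  shows "summable t"
    and "(\<Sum>m. t (m + n)) \<le> (\<Sum>m. t m * weight \<delta> m) / weight \<delta> n"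
proof -
  have le: "t m \<le> t m * weight \<delta> m" for m
    using mult_left_mono[OF one_le_weight[OF \<delta>, of m] t[of m]] by simp
  show st: "summable t"
    using le t by (intro summable_comparison_test[OF _ summ]) auto
  have "(\<Sum>m. t (m + n)) * weight \<delta> n = (\<Sum>m. t (m + n) * weight \<delta> n)"
    using st by (intro suminf_mult2 summable_ignore_initial_segment)
  also have "\<dots> \<le> (\<Sum>m. t (m + n) * weight \<delta> (m + n))"
    using st summ t \<delta> by (intro suminf_le mult_left_mono weight_mono summable_mult2
        summable_ignore_initial_segment[of "\<lambda>m. t m * weight \<delta> m"] summable_ignore_initial_segment) auto
  also have "\<dots> \<le> (\<Sum>m. t m * weight \<delta> m)"
    using suminf_split_initial_segment[OF summ, of n] t by (simp add: sum_nonneg)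
  finally show "(\<Sum>m. t (m + n)) \<le> (\<Sum>m. t m * weight \<delta> m) / weight \<delta> n"
    by (simp add: field_simps)
qed

text \<open>The multiplicative order of \<open>z\<close> divides every exponent in \<open>S\<close>,
  hence their gcd.\<close>

lemma Gcd_power_eq_1:
  fixes z :: "'a::field"
  assumes "Gcd S = (1::nat)" and "\<And>n. n \<in> S \<Longrightarrow> z ^ n = 1" and "0 \<notin> S"
  shows "z = 1"
proof -
  have "S \<noteq> {}"
    using assms(1) by auto
  then obtain n where "n \<in> S"
    by auto
  then have ex: "0 < n \<and> z ^ n = 1"
    using assms by (metis gr0I)
  define d where "d = (LEAST n. 0 < n \<and> z ^ n = 1)"
  have d: "0 < d \<and> z ^ d = 1"
    unfolding d_def by (rule LeastI[of "\<lambda>n. 0 < n \<and> z ^ n = 1", OF ex])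
  have "d dvd n" if "n \<in> S" for n
  proof -
    have "z ^ n = (z ^ d) ^ (n div d) * z ^ (n mod d)"
      by (simp flip: power_mult power_add)
    then have "z ^ (n mod d) = 1"
      using d assms(2)[OF that] by simp
    moreover have "n mod d < d"
      using d by simp
    ultimately have "n mod d = 0"
      using not_less_Least[of "n mod d" "\<lambda>n. 0 < n \<and> z ^ n = 1"] unfolding d_def[symmetric] by auto
    then show ?thesis
      by auto
  qed
  then have "d dvd Gcd S"
    by (rule Gcd_greatest)
  then have "d = 1"
    using assms(1) by simp
  then show ?thesis
    using d by simp
qed

text \<open>In generating functions the hypotheses read \<open>(1 - X F) U = 1\<close> and
  \<open>(1 - X F) V = A\<close>, so \<open>V = A U\<close>.\<close>

lemma renewal_convolution:
  fixes a f u v :: "nat \<Rightarrow> real"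
  assumes u: "\<And>n. u n = (if n = 0 then 1 else 0) + (\<Sum>s<n. f s * u (n - Suc s))"
    and v: "\<And>n. v n = a n + (\<Sum>s<n. f s * v (n - Suc s))"
  shows "v n = (\<Sum>l\<le>n. a l * u (n - l))"
proof -
  have eq: "(1 - fps_X * Abs_fps f) * Abs_fps w = Abs_fps c"
    if w: "\<And>n. w n = c n + (\<Sum>s<n. f s * w (n - Suc s))" for w c :: "nat \<Rightarrow> real"
  proof (rule fps_ext)
    fix n
    show "fps_nth ((1 - fps_X * Abs_fps f) * Abs_fps w) n = fps_nth (Abs_fps c) n"
      using w[of n]
      by (cases n) (simp_all add: left_diff_distrib mult.assoc fps_mult_nth[of "Abs_fps f"]
          atLeast0AtMost lessThan_Suc_atMost)
  qed
  have "Abs_fps (\<lambda>n. if n = 0 then 1 else 0) = (1 :: real fps)"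
    by (simp add: fps_eq_iff)
  then have U: "(1 - fps_X * Abs_fps f) * Abs_fps u = 1"
    using eq[OF u] by simp
  have "Abs_fps v = ((1 - fps_X * Abs_fps f) * Abs_fps u) * Abs_fps v"
    by (simp add: U)
  also have "\<dots> = Abs_fps a * Abs_fps u"
    by (simp add: eq[OF v, symmetric] mult_ac)
  finally have "fps_nth (Abs_fps v) n = fps_nth (Abs_fps a * Abs_fps u) n"
    by simp
  then show ?thesis
    by (simp add: fps_mult_nth atLeast0AtMost)
qed

text \<open>A recurrent renewal process: a gap exceeds \<open>n\<close> with probability
  \<open>t n\<close> and equals \<open>n + 1\<close> with probability \<open>f n\<close>;
  \<open>u n\<close> is the probability of a renewal at time \<open>n\<close>.\<close>

locale renewal =
  fixes t f u :: "nat \<Rightarrow> real" and \<delta> :: real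
  assumes \<delta>: "0 \<le> \<delta>"
    and t_0: "t 0 = 1" and t_Suc: "\<And>n. t (Suc n) = t n - f n"
    and t_nonneg: "\<And>n. 0 \<le> t n" and f_nonneg: "\<And>n. 0 \<le> f n" and u_nonneg: "\<And>n. 0 \<le> u n"
    and u_eq: "\<And>n. u n = (if n = 0 then 1 else 0) + (\<Sum>s<n. f s * u (n - Suc s))"
    and aperiodic: "Gcd {n. n \<ge> 1 \<and> u n > 0} = 1"
    and summ: "summable (\<lambda>n. t n * weight \<delta> n)"
begin

text \<open>The mean gap, by the tail sum formula.\<close>

definition \<mu> :: real where "\<mu> = (\<Sum>n. t n)"

lemma summable_t: "summable t"
  using weighted_tail_le(1)[OF \<delta> t_nonneg summ] .

lemma \<mu>_pos: "0 < \<mu>"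
proof -
  have "sum t {..<1} \<le> \<mu>"
    unfolding \<mu>_def by (intro sum_le_suminf summable_t) (auto simp: t_nonneg)
  then show ?thesis
    by (simp add: t_0)
qed

text \<open>Summation by parts, valid up to the boundary of the disc because \<open>t\<close> is
  summable. At \<open>z = 1\<close> it says that \<open>f\<close> has total mass 1.\<close>

lemma f_sums: 
  fixes z :: complex
  assumes "norm z \<le> 1"
  shows "(\<lambda>n. of_real (f n) * z ^ Suc n) sums (1 - (1 - z) * (\<Sum>n. of_real (t n) * z ^ n))"
proof -
  define T where "T = (\<Sum>n. of_real (t n) * z ^ n)"
  have "norm (of_real (t n) * z ^ n) \<le> t n" for n
    using assms t_nonneg[of n] by (simp add: norm_mult norm_power mult_left_le power_le_one)
  then have "summable (\<lambda>n. of_real (t n) * z ^ n)"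
    by (intro summable_comparison_test[OF _ summable_t]) auto
  then have T: "(\<lambda>n. of_real (t n) * z ^ n) sums T"
    unfolding T_def by (rule summable_sums)
  then have "(\<lambda>n. of_real (t (Suc n)) * z ^ Suc n) sums (T - 1)"
    using sums_Suc_iff[of "\<lambda>n. of_real (t n) * z ^ n" "T - 1"] by (simp add: t_0)
  then have "(\<lambda>n. z * (of_real (t n) * z ^ n) - of_real (t (Suc n)) * z ^ Suc n) sums (z * T - (T - 1))"
    by (intro sums_diff sums_mult T)
  then show ?thesis
    unfolding T_def[symmetric] by (simp add: t_Suc algebra_simps)
qed

text \<open>A zero \<open>z\<close> would give the series of \<open>f\<close> the value 1 at
  \<open>z\<close>, the same as at 1. Comparing real parts forces \<open>z ^ Suc n = 1\<close>
  wherever \<open>f n > 0\<close>; aperiodicity then gives \<open>z = 1\<close>, where the value is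
  \<mu>, which is positive.\<close>

lemma t_nonvanishing:
  fixes z :: complex
  assumes z: "norm z \<le> 1"
  shows "(\<Sum>n. of_real (t n) * z ^ n) \<noteq> 0"
proof
  assume *: "(\<Sum>n. of_real (t n) * z ^ n) = 0"
  have "(\<lambda>n. of_real (f n) * z ^ Suc n) sums 1"
    using f_sums[OF z] * by simp
  then have "(\<lambda>n. of_real (f n) * 1 ^ Suc n - of_real (f n) * z ^ Suc n) sums (1 - 1)"
    using f_sums[of 1] by (intro sums_diff) auto
  then have "(\<lambda>n. Re (of_real (f n) * (1 - z ^ Suc n))) sums Re 0"
    by (intro sums_Re) (simp add: right_diff_distrib)
  then have sum0: "(\<lambda>n. f n * (1 - Re (z ^ Suc n))) sums 0"
    by simp
  have Re_le: "Re (z ^ n) \<le> 1" for n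
  proof -
    have "Re (z ^ n) \<le> norm (z ^ n)"
      by (rule complex_Re_le_cmod)
    also have "\<dots> \<le> 1"
      using z by (simp add: norm_power power_le_one)
    finally show ?thesis .
  qed
  have zero: "f n * (1 - Re (z ^ Suc n)) = 0" for n
  proof -
    have "0 \<le> f n * (1 - Re (z ^ Suc n))" for n
      using Re_le[of "Suc n"] f_nonneg[of n] by (intro mult_nonneg_nonneg) linarith+
    from suminf_eq_zero_iff[OF sums_summable[OF sum0] this] show ?thesis
      using sums_unique[OF sum0] by simp
  qed
  have root: "z ^ Suc n = 1" if "f n > 0" for n
  proof -
    have "Re (z ^ Suc n) = 1"
      using zero[of n] that by simp
    moreover have "norm (z ^ Suc n) \<le> 1"
      unfolding norm_power using z by (intro power_le_one) auto
    ultimately have "Im (z ^ Suc n) = 0"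
      by (metis abs_square_le_1 add_le_same_cancel1 cmod_power2 norm_ge_zero abs_of_nonneg one_power2 power2_less_eq_zero_iff)
    with \<open>Re (z ^ Suc n) = 1\<close> show ?thesis
      by (simp add: complex_eq_iff)
  qed
  \<comment> \<open>By the renewal equation every \<open>n\<close> with \<open>u n > 0\<close> is a
    sum of possible gaps, so the root property passes from \<open>f\<close> to
    \<open>u\<close>.\<close>
  have u_root: "z ^ n = 1" if "u n > 0" for n
    using that
  proof (induction n rule: less_induct)
    case (less n)
    show ?case
    proof (cases "n = 0")
      case False
      then have "0 < (\<Sum>s<n. f s * u (n - Suc s))"
        using less.prems u_eq[of n] by simp
      then obtain s where s: "s < n" "0 < f s * u (n - Suc s)"
        using sum_nonpos[of "{..<n}" "\<lambda>s. f s * u (n - Suc s)"] by (force simp: not_le[symmetric])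
      then have "f s > 0" "u (n - Suc s) > 0"
        using f_nonneg[of s] u_nonneg[of "n - Suc s"] by (auto simp: zero_less_mult_iff)
      then have "z ^ Suc s * z ^ (n - Suc s) = 1"
        using less.IH[of "n - Suc s"] root[of s] s(1) by simp
      then show ?thesis
        unfolding power_add[symmetric] using s(1) by simp
    qed simp
  qed
  have "z = 1"
    by (rule Gcd_power_eq_1[OF aperiodic]) (use u_root in blast, simp)
  then have "(\<Sum>n. complex_of_real (t n)) = 0"
    using * by simp
  moreover have "(\<Sum>n. complex_of_real (t n)) = of_real \<mu>"
    unfolding \<mu>_def using summable_t by (rule suminf_of_real[symmetric])
  ultimately show False
    using \<mu>_pos by simp
qed

text \<open>
  With \<open>T\<close>, \<open>U\<close> the generating functions of \<open>t\<close>, \<open>u\<close> and \<open>R\<close> that of the tail sums of \<open>t\<close>, the identity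
  \<open>(1 - X) T U = 1\<close> gives \<open>U - 1/(\<mu>(1 - X)) = R/(\<mu>T)\<close>: the tail sums of \<open>t\<close> have the claimed decay,
  and by Wiener's lemma convolution with the coefficients of \<open>1/T\<close> preserves it.
\<close>

lemma renewal_rate: "\<exists>C. \<forall>n. \<bar>u n - 1 / \<mu>\<bar> \<le> C / weight \<delta> n"
proof -
  define T U F where "T = Abs_fps (\<lambda>n. complex_of_real (t n))"
    and "U = Abs_fps (\<lambda>n. complex_of_real (u n))" and "F = Abs_fps (\<lambda>n. complex_of_real (f n))"
  define J where "J = (Abs_fps (\<lambda>_. 1) :: complex fps)"
  \<comment> \<open>Starting the tail at \<open>Suc n\<close> is the shift that makes
    \<open>(1 - fps_X) * R\<close> equal to the constant \<mu> minus \<open>T\<close>.\<close>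
  define r where "r n = (\<Sum>m. t (m + Suc n))" for n
  define R where "R = Abs_fps (\<lambda>n. complex_of_real (r n))"
  define D where "D = U - fps_const (of_real (1 / \<mu>)) * J"
  have r: "r n = \<mu> - (\<Sum>m\<le>n. t m)" for n
    using suminf_split_initial_segment[OF summable_t, of "Suc n"]
    by (simp add: r_def \<mu>_def lessThan_Suc_atMost)
  have T: "(1 - fps_X) * T = 1 - fps_X * F"
  proof (rule fps_ext)
    show "fps_nth ((1 - fps_X) * T) n = fps_nth (1 - fps_X * F) n" for n
      by (cases n) (auto simp: left_diff_distrib T_def F_def t_0 t_Suc)
  qed
  have "U = 1 + fps_X * (F * U)"
  proof (rule fps_ext)
    show "fps_nth U n = fps_nth (1 + fps_X * (F * U)) n" for n
      using arg_cong[OF u_eq[of n], of complex_of_real]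
      by (cases n) (simp_all add: U_def F_def fps_mult_nth[of "Abs_fps _"] atLeast0AtMost lessThan_Suc_atMost)
  qed
  then have TU: "(1 - fps_X) * T * U = 1"
    unfolding T by (simp add: algebra_simps)
  have J: "(1 - fps_X) * J = 1"
  proof (rule fps_ext)
    show "fps_nth ((1 - fps_X) * J) n = fps_nth 1 n" for n
      by (cases n) (auto simp: left_diff_distrib J_def)
  qed
  have R: "(1 - fps_X) * R = fps_const (of_real \<mu>) - T"
  proof (rule fps_ext)
    show "fps_nth ((1 - fps_X) * R) n = fps_nth (fps_const (of_real \<mu>) - T) n" for n
      by (cases n) (auto simp: left_diff_distrib R_def T_def r)
  qed
  \<comment> \<open>Stated for arbitrary series, so that the products \<open>a * T * U\<close>,
    \<open>m * i\<close> and \<open>a * J\<close> appear as blocks; each equals 1 in the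
    application.\<close>
  have ring: "a * (m * T * (U - i * J)) = m * (a * T * U) - (m * i) * T * (a * J)" for a m i
    by (simp add: algebra_simps)
  have "(1 - fps_X) * (fps_const (of_real \<mu>) * T * D)
      = fps_const (of_real \<mu>) * ((1 - fps_X) * T * U)
        - (fps_const (of_real \<mu>) * fps_const (of_real (1 / \<mu>))) * T * ((1 - fps_X) * J)"
    unfolding D_def by (rule ring)
  also have "fps_const (of_real \<mu>) * fps_const (of_real (1 / \<mu>)) = (1 :: complex fps)"
    using \<mu>_pos by (simp add: fps_const_mult flip: of_real_mult)
  also have "fps_const (of_real \<mu>) * ((1 - fps_X) * T * U) - 1 * T * ((1 - fps_X) * J) = (1 - fps_X) * R"
    by (simp add: TU J R)
  finally have "(1 - fps_X) * (fps_const (of_real \<mu>) * T * D) = (1 - fps_X) * R" .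
  moreover have "(1 - fps_X :: complex fps) \<noteq> 0"
    using J by auto
  ultimately have TD: "fps_const (of_real \<mu>) * T * D = R"
    by simp
  have "fps_nth T 0 \<noteq> 0"
    by (simp add: T_def t_0)
  have "inverse T * R = fps_const (of_real \<mu>) * ((inverse T * T) * D)"
    unfolding TD[symmetric] by (simp only: mult_ac)
  also have "\<dots> = fps_const (of_real \<mu>) * D"
    using inverse_mult_eq_1[OF \<open>fps_nth T 0 \<noteq> 0\<close>] by simp
  finally have D: "fps_const (of_real \<mu>) * D = inverse T * R" ..

  have summ_inv: "summable (\<lambda>n. norm (fps_nth (inverse T) n) * weight \<delta> n)"
    using summ t_nonvanishing t_nonneg by (intro weighted_wiener \<delta>) (auto simp: T_def)
  define S where "S = (\<Sum>m. t m * weight \<delta> m)"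
  have S_nonneg: "0 \<le> S"
    unfolding S_def using summ t_nonneg by (intro suminf_nonneg) auto
  have r_nonneg: "0 \<le> r n" for n
    unfolding r_def using t_nonneg by (intro suminf_nonneg summable_ignore_initial_segment[OF summable_t]) auto
  have "r n \<le> S / weight \<delta> n" for n
  proof -
    have "r n \<le> S / weight \<delta> (Suc n)"
      unfolding r_def S_def by (rule weighted_tail_le(2)[OF \<delta> t_nonneg summ])
    also have "\<dots> \<le> S / weight \<delta> n"
      using S_nonneg weight_mono[OF \<delta>, of n "Suc n"] by (intro divide_left_mono) auto
    finally show ?thesis .
  qed
  then have "norm (fps_nth R n) \<le> S / weight \<delta> n" for n
    using r_nonneg[of n] by (simp add: R_def)
  from convolution_decay[OF \<delta> summ_inv this]
  have "norm (fps_nth (inverse T * R) n)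
      \<le> (\<Sum>m. norm (fps_nth (inverse T) m) * weight \<delta> m) * S / weight \<delta> n" for n
    by (simp add: fps_mult_nth atLeast0AtMost)
  moreover have "norm (fps_nth (inverse T * R) n) = \<mu> * \<bar>u n - 1 / \<mu>\<bar>" for n
  proof -
    have "fps_nth (inverse T * R) n = of_real (\<mu> * (u n - 1 / \<mu>))"
      unfolding D[symmetric] by (simp add: D_def U_def J_def)
    then show ?thesis
      using \<mu>_pos by (simp only: norm_of_real abs_mult abs_of_pos)
  qed
  ultimately have "\<bar>u n - 1 / \<mu>\<bar> \<le> (\<Sum>m. norm (fps_nth (inverse T) m) * weight \<delta> m) * S / \<mu> / weight \<delta> n" for n
    using \<mu>_pos by (simp add: field_simps)
  then show ?thesis
    by blast
qed

end

section \<open>Convergence to the stationary distribution\<close>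

text \<open>A path from \<open>j\<close> to \<open>A\<close>, cut at its last visit to
  \<open>j\<close>, leaves a piece that does not return to \<open>j\<close>. The induction removes
  one first return at a time.\<close>

lemma ex_taboo_pos:
  "0 < measure (measure_pmf (step_pmf K n j)) A \<Longrightarrow> \<exists>m. 0 < taboo K j A m j"
proof (induction n rule: less_induct)
  case (less n)
  show ?case
  proof (cases "0 < taboo K j A n j")
    case False
    then have "taboo K j A n j = 0"
      using taboo_nonneg[of K j A n j] by linarith
    then have "(\<Sum>s<n. hit K j s j * measure (measure_pmf (step_pmf K (n - Suc s) j)) A) \<noteq> 0"
      using less.prems first_passage[of K n j A j] by simp
    then obtain s where "s < n" "hit K j s j * measure (measure_pmf (step_pmf K (n - Suc s) j)) A \<noteq> 0"
      by (rule sum.not_neutral_contains_not_neutral) auto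
    then show ?thesis
      using less.IH[of "n - Suc s"] by (auto simp: zero_less_measure_iff)
  qed auto
qed

text \<open>A path from \<open>j\<close> to \<open>i\<close> without return, continued by a
  surviving path from \<open>i\<close>, survives from \<open>j\<close>. This transfers tail bounds
  from \<open>j\<close> to any start.\<close>

lemma survival_comparable:
  assumes "0 < measure (measure_pmf (step_pmf K n j)) {i}"
  shows "\<exists>c>0. \<forall>n. c * survival K j n i \<le> survival K j n j"
proof -
  obtain m where m: "0 < taboo K j {i} m j"
    using ex_taboo_pos[OF assms] by blast
  have "taboo K j {i} m j * survival K j n i \<le> survival K j n j" for n
    using taboo_mult_survival_le[of K j i m j n] decseqD[OF decseq_survival, of n "m + n" K j j] by simp
  with m show ?thesis
    by blast
qed

lemma ex_hit_pos:
  assumes "0 < measure (measure_pmf (step_pmf K n i)) {j}" and "i \<noteq> j"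
  shows "\<exists>m. 0 < hit K j m i"
proof -
  have "taboo K j {j} n i = 0"
    using \<open>i \<noteq> j\<close> by (cases n) (auto simp: taboo_self)
  then have "(\<Sum>s<n. hit K j s i * measure (measure_pmf (step_pmf K (n - Suc s) j)) {j}) \<noteq> 0"
    using assms(1) first_passage[of K n i "{j}" j] by simp
  then obtain s where "hit K j s i * measure (measure_pmf (step_pmf K (n - Suc s) j)) {j} \<noteq> 0"
    by (rule sum.not_neutral_contains_not_neutral) auto
  then have "hit K j s i \<noteq> 0"
    by auto
  then show ?thesis
    using hit_nonneg[of K j s i] by (intro exI[of _ s]) linarith
qed

section \<open>Chapman-Kolmogorov and stationarity\<close>

lemma step_pmf_add: "step_pmf K (m + n) i = bind_pmf (step_pmf K m i) (step_pmf K n)"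
  by (induction m arbitrary: i) (auto simp: bind_return_pmf bind_assoc_pmf intro!: bind_pmf_cong)

lemma measure_step_pmf_add_ge:
  "measure (measure_pmf (step_pmf K m i)) {k} * measure (measure_pmf (step_pmf K n k)) A
     \<le> measure (measure_pmf (step_pmf K (m + n) i)) A"
proof -
  have "measure (measure_pmf (step_pmf K m i)) {k} * measure (measure_pmf (step_pmf K n k)) A
      = (\<integral>l. indicator {k} l * measure (measure_pmf (step_pmf K n k)) A \<partial>measure_pmf (step_pmf K m i))"
    by simp
  also have "\<dots> \<le> (\<integral>l. measure (measure_pmf (step_pmf K n l)) A \<partial>measure_pmf (step_pmf K m i))"
    by (intro integral_mono integrable_unit_interval) (auto simp: indicator_def)
  finally show ?thesis
    by (simp add: step_pmf_add measure_bind_pmf)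
qed

lemma stationary_step_pmf: "bind_pmf \<pi> K = \<pi> \<Longrightarrow> bind_pmf \<pi> (step_pmf K n) = \<pi>"
proof (induction n)
  case 0
  have "step_pmf K 0 = return_pmf"
    by (rule ext) simp
  then show ?case
    by (simp add: bind_return_pmf')
next
  case (Suc n)
  have "bind_pmf \<pi> (step_pmf K (Suc n)) = bind_pmf (bind_pmf \<pi> K) (step_pmf K n)"
    unfolding bind_assoc_pmf by (intro bind_pmf_cong) auto
  then show ?case
    by (simp only: Suc.IH Suc.prems)
qed

text \<open>Some state carries mass; irreducibility moves part of it to \<open>k\<close>, and
  stationarity keeps it there.\<close>

lemma stationary_pmf_pos:
  assumes "bind_pmf \<pi> K = \<pi>" and irr: "\<And>i k. \<exists>n. 0 < measure (measure_pmf (step_pmf K n i)) {k}"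
  shows "0 < pmf \<pi> k"
proof -
  obtain i where i: "i \<in> set_pmf \<pi>"
    using set_pmf_not_empty by fast
  obtain n where "0 < measure (measure_pmf (step_pmf K n i)) {k}"
    using irr by blast
  then have "k \<in> set_pmf (step_pmf K n i)"
    by (simp add: measure_pmf_single pmf_positive_iff)
  then have "k \<in> set_pmf (bind_pmf \<pi> (step_pmf K n))"
    using i by auto
  then show ?thesis
    by (simp add: stationary_step_pmf[OF assms(1)] pmf_positive_iff)
qed

text \<open>The renewal rate at \<open>j\<close> is extended first to all target sets, by the last
  visit to \<open>j\<close>, then to all starts, by the first visit. No constant depends on
  \<open>A\<close>, because survival dominates all taboo probabilities.\<close>

lemma ergodic_rate:
  fixes K :: "'s \<Rightarrow> 's pmf"
  assumes irr: "\<And>i k. \<exists>n. 0 < measure (measure_pmf (step_pmf K n i)) {k}"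
    and aper: "Gcd {n. n \<ge> 1 \<and> 0 < measure (measure_pmf (step_pmf K n j)) {j}} = 1"
    and stat: "bind_pmf \<pi> K = \<pi>"
    and "0 < \<delta>" and summ: "summable (\<lambda>n. survival K j n j * weight \<delta> n)"
  shows "\<exists>C. \<forall>n A. \<bar>measure (measure_pmf (step_pmf K n i)) A - measure (measure_pmf \<pi>) A\<bar> \<le> C / weight \<delta> n"
proof -
  have \<delta>: "0 \<le> \<delta>"
    using \<open>0 < \<delta>\<close> by simp
  define P where "P n i A = measure (measure_pmf (step_pmf K n i)) A" for n i A
  define u where "u n = P n j {j}" for n
  let ?t = "\<lambda>n. survival K j n j"
  have u_eq: "u n = (if n = 0 then 1 else 0) + (\<Sum>s<n. hit K j s j * u (n - Suc s))" for n
    using first_passage[of K n j "{j}" j] by (cases n) (auto simp: u_def P_def taboo_self)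
  interpret renewal ?t "\<lambda>n. hit K j n j" u \<delta>
  proof
    show "u n = (if n = 0 then 1 else 0) + (\<Sum>s<n. hit K j s j * u (n - Suc s))" for n
      by (rule u_eq)
  qed (use \<delta> aper summ in \<open>auto simp: survival_Suc u_def P_def\<close>)
  obtain C1 where C1: "\<And>n. \<bar>u n - 1 / \<mu>\<bar> \<le> C1 / weight \<delta> n"
    using renewal_rate by blast
  define S where "S = (\<Sum>n. ?t n * weight \<delta> n)"
  \<comment> \<open>The cycle formula: expected time in \<open>A\<close> between visits to
    \<open>j\<close>, divided by the mean return time. It is identified with \<pi> only at the
    end.\<close>
  define \<nu> where "\<nu> A = (\<Sum>l. taboo K j A l j) / \<mu>" for A
  have taboo_summable: "summable (\<lambda>l. taboo K j A l j)" for A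
    by (intro summable_comparison_test[OF _ summable_t]) (auto intro: taboo_mono)
  have \<nu>_bounds: "0 \<le> \<nu> A" "\<nu> A \<le> 1" for A
  proof -
    have "(\<Sum>l. taboo K j A l j) \<le> \<mu>"
      unfolding \<mu>_def by (intro suminf_le taboo_summable taboo_mono) auto
    moreover have "0 \<le> (\<Sum>l. taboo K j A l j)"
      by (intro suminf_nonneg taboo_summable) auto
    ultimately show "0 \<le> \<nu> A" "\<nu> A \<le> 1"
      using \<mu>_pos by (auto simp: \<nu>_def)
  qed

  \<comment> \<open>The first term bounds the error from replacing \<open>u\<close> by its limit,
    the second the part of the series for \<nu> beyond \<open>n\<close>.\<close>
  define C2 where "C2 = S * C1 + S / \<mu>"
  have from_j: "\<bar>P n j A - \<nu> A\<bar> \<le> C2 / weight \<delta> n" for n A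
  proof -
    let ?a = "\<lambda>l. taboo K j A l j"
    \<comment> \<open>Decomposition at the last visit to \<open>j\<close>, at time
      \<open>n - l\<close>, obtained by solving the first passage equation.\<close>
    have "P n j A = (\<Sum>l\<le>n. ?a l * u (n - l))"
    proof (rule renewal_convolution[where v = "\<lambda>n. P n j A", OF u_eq])
      show "P n j A = ?a n + (\<Sum>s<n. hit K j s j * P (n - Suc s) j A)" for n
        unfolding P_def by (rule first_passage)
    qed
    moreover have "\<nu> A = (\<Sum>l\<le>n. ?a l / \<mu>) + (\<Sum>l. ?a (l + Suc n)) / \<mu>"
      unfolding \<nu>_def using suminf_split_initial_segment[OF taboo_summable, of A "Suc n"]
      by (simp add: lessThan_Suc_atMost sum_divide_distrib add_divide_distrib del: sum.lessThan_Suc)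
    ultimately have "P n j A - \<nu> A = (\<Sum>l\<le>n. ?a l * (u (n - l) - 1 / \<mu>)) - (\<Sum>l. ?a (l + Suc n)) / \<mu>"
      by (simp add: right_diff_distrib sum_subtractf)
    moreover have "\<bar>\<Sum>l\<le>n. ?a l * (u (n - l) - 1 / \<mu>)\<bar> \<le> S * C1 / weight \<delta> n"
    proof -
      have le: "norm (?a l) * weight \<delta> l \<le> ?t l * weight \<delta> l" for l
        by (intro mult_right_mono) (auto intro: taboo_mono)
      have sa: "summable (\<lambda>l. norm (?a l) * weight \<delta> l)"
        using le by (intro summable_comparison_test[OF _ summ]) auto
      have "\<bar>\<Sum>l\<le>n. ?a l * (u (n - l) - 1 / \<mu>)\<bar> \<le> (\<Sum>l. norm (?a l) * weight \<delta> l) * C1 / weight \<delta> n"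
        using convolution_decay[OF \<delta> sa, of "\<lambda>l. u l - 1 / \<mu>" C1 n] C1 by simp
      also have "\<dots> \<le> S * C1 / weight \<delta> n"
      proof -
        have "0 \<le> C1"
          using C1[of 0] by simp
        moreover have "(\<Sum>l. norm (?a l) * weight \<delta> l) \<le> S"
          unfolding S_def by (intro suminf_le le sa summ)
        ultimately show ?thesis
          by (intro divide_right_mono mult_right_mono) auto
      qed
      finally show ?thesis .
    qed
    moreover have "\<bar>(\<Sum>l. ?a (l + Suc n)) / \<mu>\<bar> \<le> S / \<mu> / weight \<delta> n"
    proof -
      have "0 \<le> (\<Sum>l. ?a (l + Suc n))"
        by (intro suminf_nonneg summable_ignore_initial_segment[OF taboo_summable]) auto
      moreover have "(\<Sum>l. ?a (l + Suc n)) \<le> (\<Sum>l. ?t (l + Suc n))"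
        by (intro suminf_le summable_ignore_initial_segment[OF taboo_summable]
            summable_ignore_initial_segment[OF summable_t] taboo_mono) auto
      moreover have "(\<Sum>l. ?t (l + Suc n)) \<le> S / weight \<delta> (Suc n)"
        unfolding S_def by (rule weighted_tail_le(2)[OF \<delta> t_nonneg summ])
      moreover have "S / weight \<delta> (Suc n) \<le> S / weight \<delta> n"
      proof (rule divide_left_mono)
        show "0 \<le> S"
          unfolding S_def using summ by (intro suminf_nonneg) auto
      qed (use weight_mono[OF \<delta>, of n "Suc n"] in auto)
      ultimately show ?thesis
        using \<mu>_pos divide_right_mono[of "\<Sum>l. ?a (l + Suc n)" "S / weight \<delta> n" \<mu>] by (simp add: mult.commute)
    qed
    ultimately show ?thesis
      unfolding C2_def add_divide_distrib by linarith
  qed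
  have C2_nonneg: "0 \<le> C2"
    using from_j[of 0 "{}"] by simp

  have from_i: "\<exists>C. \<forall>n A. \<bar>P n i A - \<nu> A\<bar> \<le> C / weight \<delta> n" for i
  proof -
    obtain n0 where n0: "0 < measure (measure_pmf (step_pmf K n0 j)) {i}"
      using irr[of j i] by (elim exE)
    obtain c where c: "c > 0" "\<And>n. c * survival K j n i \<le> survival K j n j"
      using survival_comparable[OF n0] by (elim exE conjE) metis
    have si: "summable (\<lambda>n. survival K j n i * weight \<delta> n)"
    proof (rule summable_comparison_test[OF _ summable_mult[OF summ, of "1 / c"]], intro exI allI impI)
      fix n
      have "survival K j n i \<le> 1 / c * survival K j n j"
        using c(2)[of n] c(1) by (simp add: field_simps)
      then show "norm (survival K j n i * weight \<delta> n) \<le> 1 / c * (survival K j n j * weight \<delta> n)"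
        using mult_right_mono[of "survival K j n i" "1 / c * survival K j n j" "weight \<delta> n"] by simp
    qed
    define Si where "Si = (\<Sum>n. survival K j n i * weight \<delta> n)"
    have hit_le: "hit K j s i \<le> survival K j s i" for s
      using survival_Suc[of K j s i] taboo_nonneg[of K j UNIV "Suc s" i] by linarith
    then have hit_le': "norm (hit K j s i) * weight \<delta> s \<le> survival K j s i * weight \<delta> s" for s
      by (intro mult_right_mono) auto
    have sh: "summable (\<lambda>s. norm (hit K j s i) * weight \<delta> s)"
      using hit_le' by (intro summable_comparison_test[OF _ si]) auto
    have Sh_le: "(\<Sum>s. norm (hit K j s i) * weight \<delta> s) \<le> Si"
      unfolding Si_def by (intro suminf_le hit_le' sh si)
    have surv_le: "survival K j n i \<le> Si / weight \<delta> n" for n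
    proof -
      have "sum (\<lambda>n. survival K j n i * weight \<delta> n) {n} \<le> Si"
        unfolding Si_def using si by (intro sum_le_suminf) auto
      then show ?thesis
        by (simp add: field_simps)
    qed
    have Si_nonneg: "0 \<le> Si"
      unfolding Si_def using si by (intro suminf_nonneg) auto
    \<comment> \<open>\<open>hit K j s i\<close> refers to time \<open>s + 1\<close>, so the
      convolution ends at \<open>n - 1\<close>; the factor \<open>weight \<delta> 1\<close> restores
      the weight at \<open>n\<close>.\<close>
    have conv: "\<bar>\<Sum>s<n. hit K j s i * (P (n - Suc s) j A - \<nu> A)\<bar> \<le> Si * C2 * weight \<delta> 1 / weight \<delta> n" for n A
    proof (cases n)
      case 0
      then show ?thesis
        using Si_nonneg C2_nonneg by simp
    next
      case (Suc m)
      have "\<bar>\<Sum>s\<le>m. hit K j s i * (P (m - s) j A - \<nu> A)\<bar>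
          \<le> (\<Sum>s. norm (hit K j s i) * weight \<delta> s) * C2 / weight \<delta> m"
        using convolution_decay[OF \<delta> sh, of "\<lambda>l. P l j A - \<nu> A" C2 m] from_j by simp
      also have "\<dots> \<le> Si * C2 / weight \<delta> m"
        using Sh_le C2_nonneg by (intro divide_right_mono mult_right_mono) auto
      also have "\<dots> \<le> Si * C2 * weight \<delta> 1 / weight \<delta> n"
      proof -
        have "Si * C2 * weight \<delta> n \<le> Si * C2 * (weight \<delta> m * weight \<delta> 1)"
          using weight_add_le[OF \<delta>, of m 1] Si_nonneg C2_nonneg by (intro mult_left_mono) (auto simp: Suc)
        then show ?thesis
          by (simp add: divide_simps mult_ac)
      qed
      finally show ?thesis
        by (simp add: Suc lessThan_Suc_atMost del: sum.lessThan_Suc)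
    qed
    \<comment> \<open>The two survival terms come from being in \<open>A\<close> before any visit to
      \<open>j\<close> and from the mass missing in the sum of \<open>hit\<close> up to
      \<open>n\<close>.\<close>
    have "\<bar>P n i A - \<nu> A\<bar> \<le> (2 * Si + Si * C2 * weight \<delta> 1) / weight \<delta> n" for n A
    proof -
      have "(\<Sum>s<n. hit K j s i * (P (n - Suc s) j A - \<nu> A))
          = (\<Sum>s<n. hit K j s i * P (n - Suc s) j A) - (1 - survival K j n i) * \<nu> A"
        by (simp add: right_diff_distrib sum_subtractf sum_hit flip: sum_distrib_right)
      then have "P n i A - \<nu> A = taboo K j A n i
          + (\<Sum>s<n. hit K j s i * (P (n - Suc s) j A - \<nu> A)) - survival K j n i * \<nu> A"
        using first_passage[of K n i A j] by (simp add: P_def algebra_simps)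
      moreover have "taboo K j A n i \<le> survival K j n i"
        by (rule taboo_mono) simp
      moreover have "survival K j n i * \<nu> A \<le> survival K j n i" "0 \<le> survival K j n i * \<nu> A"
        using \<nu>_bounds[of A] by (auto simp: mult_left_le)
      ultimately have "\<bar>P n i A - \<nu> A\<bar> \<le> 2 * survival K j n i
          + \<bar>\<Sum>s<n. hit K j s i * (P (n - Suc s) j A - \<nu> A)\<bar>"
        using taboo_nonneg[of K j A n i] by linarith
      also have "\<dots> \<le> 2 * (Si / weight \<delta> n) + Si * C2 * weight \<delta> 1 / weight \<delta> n"
        using surv_le[of n] conv[of n A] by linarith
      finally show ?thesis
        by (simp add: add_divide_distrib)
    qed
    then show ?thesis
      by blast
  qed
  have lim: "(\<lambda>n. P n k A) \<longlonglongrightarrow> \<nu> A" for k A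
  proof -
    obtain C where C: "\<And>n A. \<bar>P n k A - \<nu> A\<bar> \<le> C / weight \<delta> n"
      using from_i[of k] by blast
    have "(\<lambda>n. C / weight \<delta> n) \<longlonglongrightarrow> 0"
      unfolding weight_def using \<open>0 < \<delta>\<close> by real_asymp
    then have "(\<lambda>n. P n k A - \<nu> A) \<longlonglongrightarrow> 0"
      by (rule Lim_null_comparison[rotated]) (use C in auto)
    then show ?thesis
      by (simp add: LIM_zero_iff)
  qed
  \<comment> \<open>Averaged over a stationary start, the probabilities are constant in
    \<open>n\<close>, so dominated convergence identifies the limit.\<close>
  have "measure (measure_pmf \<pi>) A = \<nu> A" for A
  proof -
    have "(\<lambda>n. \<integral>k. P n k A \<partial>measure_pmf \<pi>) \<longlonglongrightarrow> (\<integral>k. \<nu> A \<partial>measure_pmf \<pi>)"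
      by (rule integral_dominated_convergence[where w = "\<lambda>_. 1"]) (use lim in \<open>auto simp: P_def\<close>)
    moreover have "(\<integral>k. P n k A \<partial>measure_pmf \<pi>) = measure (measure_pmf \<pi>) A" for n
      using stationary_step_pmf[OF stat, of n] measure_bind_pmf[of \<pi> "step_pmf K n" A] by (simp add: P_def)
    ultimately show ?thesis
      by (simp add: LIMSEQ_const_iff)
  qed
  then show ?thesis
    using from_i[of i] by (simp add: P_def)
qed

section \<open>A lower bound for the summed autocovariances\<close>

text \<open>By \<open>measure_path_pmf_avoid\<close>, the stationary probability of not meeting
  \<open>j\<close> at times 0 to \<open>n\<close>.\<close>

definition avoid :: "('s \<Rightarrow> 's pmf) \<Rightarrow> 's pmf \<Rightarrow> 's \<Rightarrow> nat \<Rightarrow> real" where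
  "avoid K \<pi> j n = (\<integral>k. indicator (- {j}) k * survival K j n k \<partial>measure_pmf \<pi>)"

lemma avoid_nonneg: "0 \<le> avoid K \<pi> j n"
  unfolding avoid_def by (intro integral_nonneg_AE) auto

text \<open>By stationarity the time window may be shifted to 1 up to \<open>n + 1\<close>; then
  split on whether the chain starts at \<open>j\<close>.\<close>

lemma avoid_Suc:
  assumes "bind_pmf \<pi> K = \<pi>"
  shows "avoid K \<pi> j n = avoid K \<pi> j (Suc n) + pmf \<pi> j * survival K j (Suc n) j"
proof -
  have "avoid K \<pi> j n = (\<integral>k. survival K j (Suc n) k \<partial>measure_pmf \<pi>)"
    unfolding avoid_def taboo_Suc
    using integral_bind_pmf[OF unit_interval_restrict[OF taboo_unit_interval], of \<pi> K "- {j}" K j UNIV n]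
    by (simp add: assms)
  also have "\<dots> = avoid K \<pi> j (Suc n) + pmf \<pi> j * survival K j (Suc n) j"
    unfolding avoid_def by (rule integral_indicator_Compl_singleton[OF taboo_unit_interval])
  finally show ?thesis .
qed

text \<open>Telescoping from \<open>n\<close> to \<open>2 * n\<close> gives \<open>n\<close>
  increments, each controlled by the smallest survival probability, that at
  \<open>2 * n\<close>.\<close>

lemma avoid_ge:
  assumes "bind_pmf \<pi> K = \<pi>"
  shows "pmf \<pi> j * (real n * survival K j (2 * n) j) \<le> avoid K \<pi> j n"
proof -
  have eq: "avoid K \<pi> j n = avoid K \<pi> j (n + k) + pmf \<pi> j * (\<Sum>s<k. survival K j (Suc (n + s)) j)" for k
  proof (induction k)
    case (Suc k)
    then show ?case
      using avoid_Suc[OF assms, of j "n + k"] by (simp add: algebra_simps)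
  qed simp
  have "real n * survival K j (2 * n) j = (\<Sum>s<n. survival K j (2 * n) j)"
    by simp
  also have "\<dots> \<le> (\<Sum>s<n. survival K j (Suc (n + s)) j)"
    by (intro sum_mono decseqD[OF decseq_survival]) auto
  finally show ?thesis
    using eq[of n] avoid_nonneg[of K \<pi> j "n + n"] mult_left_mono[OF _ pmf_nonneg[of \<pi> j]] by fastforce
qed

section \<open>Expected numbers of visits\<close>

lemma sum_shifted_convolution_le:
  fixes h p :: "nat \<Rightarrow> real"
  assumes "\<And>s. 0 \<le> h s" and p: "\<And>r. 0 \<le> p r"
  shows "(\<Sum>r\<le>n. \<Sum>s<r. h s * p (r - Suc s)) \<le> (\<Sum>s<n. h s) * (\<Sum>r\<le>n. p r)"
proof -
  have "(\<Sum>r = Suc s..n. p (r - Suc s)) \<le> (\<Sum>r\<le>n. p r)" for s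
  proof -
    have "inj_on (\<lambda>r. r - Suc s) {Suc s..n}"
      by (auto simp: inj_on_def)
    then have "(\<Sum>r = Suc s..n. p (r - Suc s)) = sum p ((\<lambda>r. r - Suc s) ` {Suc s..n})"
      by (simp add: sum.reindex)
    also have "\<dots> \<le> (\<Sum>r\<le>n. p r)"
      using p by (intro sum_mono2) auto
    finally show ?thesis .
  qed
  then have "(\<Sum>s<n. \<Sum>r = Suc s..n. h s * p (r - Suc s)) \<le> (\<Sum>s<n. h s * (\<Sum>r\<le>n. p r))"
    unfolding sum_distrib_left[symmetric] using assms(1) by (intro sum_mono mult_left_mono) auto
  then show ?thesis
    by (simp add: sum.nested_swap' sum_distrib_right)
qed

text \<open>Visits before reaching \<open>j\<close> give the taboo sum. After reaching
  \<open>j\<close>, which has probability \<open>1 - survival K j n k\<close>, the remaining time is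
  at most \<open>n\<close>.\<close>

lemma sum_visits_le:
  "(\<Sum>r\<le>n. measure (measure_pmf (step_pmf K r k)) A)
     \<le> (\<Sum>r\<le>n. taboo K j A r k)
       + (1 - survival K j n k) * (\<Sum>r\<le>n. measure (measure_pmf (step_pmf K r j)) A)"
  using sum_shifted_convolution_le[of "\<lambda>s. hit K j s k" "\<lambda>r. measure (measure_pmf (step_pmf K r j)) A" n]
  by (simp add: first_passage[of K _ k A j] sum.distrib sum_hit)

text \<open>A chain from elsewhere must first reach \<open>j\<close> and then has less time
  left.\<close>

lemma sum_visits_self_ge:
  "(\<Sum>r\<le>n. measure (measure_pmf (step_pmf K r k)) {j}) \<le> (\<Sum>r\<le>n. measure (measure_pmf (step_pmf K r j)) {j})"
proof (cases "k = j")
  case False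
  then have "taboo K j {j} r k = 0" for r
    by (cases r) (auto simp: taboo_self)
  moreover have "(1 - survival K j n k) * (\<Sum>r\<le>n. measure (measure_pmf (step_pmf K r j)) {j})
      \<le> 1 * (\<Sum>r\<le>n. measure (measure_pmf (step_pmf K r j)) {j})"
    by (intro mult_right_mono sum_nonneg) auto
  ultimately show ?thesis
    using sum_visits_le[of K k "{j}" n j] by simp
qed simp

lemma sum_visits_stationary:
  assumes "bind_pmf \<pi> K = \<pi>"
  shows "(\<integral>k. (\<Sum>r\<le>n. measure (measure_pmf (step_pmf K r k)) A) \<partial>measure_pmf \<pi>)
    = (real n + 1) * measure (measure_pmf \<pi>) A"
proof -
  have "(\<integral>k. (\<Sum>r\<le>n. measure (measure_pmf (step_pmf K r k)) A) \<partial>measure_pmf \<pi>)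
      = (\<Sum>r\<le>n. \<integral>k. measure (measure_pmf (step_pmf K r k)) A \<partial>measure_pmf \<pi>)"
    by (intro Bochner_Integration.integral_sum integrable_unit_interval) auto
  also have "\<dots> = (\<Sum>r\<le>n. measure (measure_pmf \<pi>) A)"
    by (simp only: measure_bind_pmf[symmetric] stationary_step_pmf[OF assms])
  finally show ?thesis
    by (simp add: algebra_simps)
qed

text \<open>The start at \<open>j\<close> maximises the expected visits to \<open>j\<close>, so it
  beats the stationary average.\<close>

lemma sum_returns_ge:
  assumes "bind_pmf \<pi> K = \<pi>"
  shows "(real n + 1) * pmf \<pi> j \<le> (\<Sum>r\<le>n. measure (measure_pmf (step_pmf K r j)) {j})"
proof -
  have "(real n + 1) * pmf \<pi> j = (\<integral>k. (\<Sum>r\<le>n. measure (measure_pmf (step_pmf K r k)) {j}) \<partial>measure_pmf \<pi>)"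
    unfolding sum_visits_stationary[OF assms] by (simp add: measure_pmf_single)
  also have "\<dots> \<le> (\<Sum>r\<le>n. measure (measure_pmf (step_pmf K r j)) {j})"
    by (intro measure_pmf.integral_le_const Bochner_Integration.integrable_sum integrable_unit_interval
        AE_I2 sum_visits_self_ge) auto
  finally show ?thesis .
qed

text \<open>Each visit to \<open>i\<close> before \<open>j\<close> leads with probability
  \<open>hit K j m i\<close> to a first hit of \<open>j\<close> exactly \<open>m + 1\<close> steps
  later. First hits at different times are disjoint, so the total is at most 1.\<close>

lemma sum_taboo_bounded:
  assumes irr: "\<And>i k. \<exists>n. 0 < measure (measure_pmf (step_pmf K n i)) {k}"
  shows "\<exists>B. \<forall>n k. k \<noteq> j \<longrightarrow> (\<Sum>r\<le>n. taboo K j {i} r k) \<le> B"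
proof (cases "i = j")
  case True
  then have "taboo K j {i} r k = 0" if "k \<noteq> j" for r k
    using that by (cases r) (auto simp: taboo_self)
  then have "\<forall>n k. k \<noteq> j \<longrightarrow> (\<Sum>r\<le>n. taboo K j {i} r k) \<le> 0"
    by simp
  then show ?thesis
    by blast
next
  case False
  obtain n where n: "0 < measure (measure_pmf (step_pmf K n i)) {j}"
    using irr[of i j] by (elim exE)
  obtain m where m: "0 < hit K j m i"
    using ex_hit_pos[OF n False] by (elim exE)
  have "(\<Sum>r\<le>n. taboo K j {i} r k) \<le> 1 / hit K j m i" for n k
  proof -
    have "(\<Sum>r\<le>n. taboo K j {i} r k) * hit K j m i \<le> (\<Sum>r\<le>n. hit K j (r + m) k)"
      unfolding sum_distrib_right by (intro sum_mono taboo_mult_hit_le)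
    also have "\<dots> = sum (\<lambda>s. hit K j s k) ((\<lambda>r. r + m) ` {..n})"
      by (simp add: sum.reindex)
    also have "\<dots> \<le> (\<Sum>s<Suc (n + m). hit K j s k)"
      by (intro sum_mono2) auto
    also have "\<dots> \<le> 1"
      unfolding sum_hit by simp
    finally show ?thesis
      using m by (simp add: field_simps)
  qed
  then show ?thesis
    by blast
qed

text \<open>Average \<open>sum_visits_le\<close> over \<pi>: the mean number of visits is known
  exactly, and starts that avoid \<open>j\<close> forfeit the visits counted from \<open>j\<close>.
  The absolute value keeps the bound valid at \<open>k = j\<close>, where \<open>B\<close> is not
  constrained.\<close>

lemma sum_visits_excess:
  assumes stat: "bind_pmf \<pi> K = \<pi>" and B: "\<And>k. k \<noteq> j \<Longrightarrow> (\<Sum>r\<le>n. taboo K j A r k) \<le> B"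
  shows "avoid K \<pi> j n * (\<Sum>r\<le>n. measure (measure_pmf (step_pmf K r j)) A) - \<bar>B\<bar>
    \<le> (\<Sum>r\<le>n. measure (measure_pmf (step_pmf K r j)) A) - (real n + 1) * measure (measure_pmf \<pi>) A"
proof -
  define W where "W = (\<Sum>r\<le>n. measure (measure_pmf (step_pmf K r j)) A)"
  have W: "0 \<le> W"
    unfolding W_def by (intro sum_nonneg) auto
  have "(\<Sum>r\<le>n. measure (measure_pmf (step_pmf K r k)) A) \<le> \<bar>B\<bar> + W * (1 - indicator (- {j}) k * survival K j n k)" for k
  proof (cases "k = j")
    case False
    then show ?thesis
      using sum_visits_le[of K k A n j] B[of k] by (simp add: W_def mult.commute)
  qed (simp add: W_def)
  then have "(\<integral>k. (\<Sum>r\<le>n. measure (measure_pmf (step_pmf K r k)) A) \<partial>measure_pmf \<pi>)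
      \<le> (\<integral>k. \<bar>B\<bar> + W * (1 - indicator (- {j}) k * survival K j n k) \<partial>measure_pmf \<pi>)"
    by (intro integral_mono Bochner_Integration.integrable_sum Bochner_Integration.integrable_add
        Bochner_Integration.integrable_diff integrable_mult_right
        integrable_restrict_unit[OF taboo_unit_interval]) (auto intro!: integrable_unit_interval)
  also have "\<dots> = \<bar>B\<bar> + W * (1 - avoid K \<pi> j n)"
    unfolding avoid_def
    using integrable_restrict_unit[OF taboo_unit_interval, of \<pi> "- {j}" K j UNIV n] by simp
  finally show ?thesis
    unfolding sum_visits_stationary[OF stat] W_def[symmetric] by (simp add: algebra_simps)
qed

text \<open>Returns to \<open>j\<close> grow linearly, and each is followed \<open>m\<close> steps
  later by \<open>i\<close> with a fixed positive probability. For \<open>2 * m \<le> n\<close> the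
  shortened horizon \<open>n - m\<close> is at least half of \<open>n\<close>.\<close>

lemma sum_visits_linear:
  assumes stat: "bind_pmf \<pi> K = \<pi>" and irr: "\<And>i k. \<exists>n. 0 < measure (measure_pmf (step_pmf K n i)) {k}"
  shows "\<exists>c>0. eventually (\<lambda>n. c * real n \<le> (\<Sum>r\<le>n. measure (measure_pmf (step_pmf K r j)) {i})) sequentially"
proof -
  obtain m where m: "0 < measure (measure_pmf (step_pmf K m j)) {i}"
    using irr by blast
  define p where "p = measure (measure_pmf (step_pmf K m j)) {i}"
  have \<pi>j: "0 < pmf \<pi> j"
    by (rule stationary_pmf_pos[OF stat irr])
  have ge: "p * pmf \<pi> j / 2 * real n \<le> (\<Sum>r\<le>n. measure (measure_pmf (step_pmf K r j)) {i})" if n: "2 * m \<le> n" for n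
  proof -
    have "p * pmf \<pi> j / 2 * real n \<le> p * ((real (n - m) + 1) * pmf \<pi> j)"
    proof -
      have "real n / 2 \<le> real (n - m) + 1"
        using n by (simp add: of_nat_diff)
      then have "(p * pmf \<pi> j) * (real n / 2) \<le> (p * pmf \<pi> j) * (real (n - m) + 1)"
        using m \<pi>j by (intro mult_left_mono) (auto simp: p_def)
      then show ?thesis
        by (simp add: mult_ac)
    qed
    also have "\<dots> \<le> p * (\<Sum>r\<le>n - m. measure (measure_pmf (step_pmf K r j)) {j})"
      by (intro mult_left_mono sum_returns_ge[OF stat]) (simp add: p_def)
    also have "\<dots> \<le> (\<Sum>r\<le>n - m. measure (measure_pmf (step_pmf K (r + m) j)) {i})"
      unfolding sum_distrib_left p_def
      using measure_step_pmf_add_ge[of K _ j j m "{i}"] by (intro sum_mono) (simp add: mult.commute)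
    also have "\<dots> = sum (\<lambda>r. measure (measure_pmf (step_pmf K r j)) {i}) ((\<lambda>r. r + m) ` {..n - m})"
      by (simp add: sum.reindex)
    also have "\<dots> \<le> (\<Sum>r\<le>n. measure (measure_pmf (step_pmf K r j)) {i})"
      using n by (intro sum_mono2) auto
    finally show ?thesis .
  qed
  have "eventually (\<lambda>n. p * pmf \<pi> j / 2 * real n \<le> (\<Sum>r\<le>n. measure (measure_pmf (step_pmf K r j)) {i})) sequentially"
    using ge by (auto intro: eventually_sequentiallyI)
  moreover have "0 < p * pmf \<pi> j / 2"
    using m \<pi>j by (simp add: p_def)
  ultimately show ?thesis
    by blast
qed

section \<open>Autocovariances and the Hurst parameter\<close>

lemma covariance_indicator:
  assumes stat: "bind_pmf \<pi> K = \<pi>"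
  shows "covariance (chain_law K \<pi>) (\<lambda>\<omega>. indicator {i} (\<omega> 0)) (\<lambda>\<omega>. indicator {i} (\<omega> r))
    = pmf \<pi> i * (measure (measure_pmf (step_pmf K r i)) {i} - pmf \<pi> i)"
proof -
  interpret prob_space "chain_law K \<pi>"
    by (rule prob_space_chain_law)
  let ?X = "\<lambda>k \<omega>. indicat_real {i} (\<omega> k)"
  have int: "integrable (chain_law K \<pi>) (?X k)" for k
    by (rule integrable_const_bound[where B = 1]) (auto simp: indicator_def)
  have int2: "integrable (chain_law K \<pi>) (\<lambda>\<omega>. ?X 0 \<omega> * ?X r \<omega>)"
    by (rule integrable_const_bound[where B = 1]) (auto simp: indicator_def)
  have E1: "expectation (?X k) = pmf \<pi> i" for k
  proof -
    have "expectation (?X k) = expectation (indicator {\<omega>. \<omega> k = i})"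
      by (intro Bochner_Integration.integral_cong) (auto simp: indicator_def)
    also have "\<dots> = prob {\<omega>. map \<omega> [0..<Suc k] ! k \<in> {i}}"
      by (simp del: upt_Suc)
    also have "\<dots> = pmf \<pi> i"
      unfolding measure_chain_law_path[of K \<pi> "\<lambda>xs. xs ! k \<in> {i}" k] measure_path_pmf_last
        measure_bind_pmf[symmetric] stationary_step_pmf[OF stat] by (rule measure_pmf_single)
    finally show ?thesis .
  qed
  have E2: "expectation (\<lambda>\<omega>. ?X 0 \<omega> * ?X r \<omega>) = pmf \<pi> i * measure (measure_pmf (step_pmf K r i)) {i}"
  proof -
    have "expectation (\<lambda>\<omega>. ?X 0 \<omega> * ?X r \<omega>) = expectation (indicator {\<omega>. \<omega> 0 = i \<and> \<omega> r = i})"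
      by (intro Bochner_Integration.integral_cong) (auto simp: indicator_def)
    also have "\<dots> = prob {\<omega>. map \<omega> [0..<Suc r] ! 0 = i \<and> map \<omega> [0..<Suc r] ! r \<in> {i}}"
      by (simp del: upt_Suc)
    also have "\<dots> = pmf \<pi> i * measure (measure_pmf (step_pmf K r i)) {i}"
      unfolding measure_chain_law_path[of K \<pi> "\<lambda>xs. xs ! 0 = i \<and> xs ! r \<in> {i}" r]
      by (rule measure_path_pmf_first_last)
    finally show ?thesis .
  qed
  define a where "a = pmf \<pi> i"
  have "covariance (chain_law K \<pi>) (?X 0) (?X r)
      = expectation (\<lambda>\<omega>. ?X 0 \<omega> * ?X r \<omega> - a * ?X 0 \<omega> - a * ?X r \<omega> + a * a)"
    unfolding covariance_def E1 a_def by (simp add: algebra_simps)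
  also have "\<dots> = expectation (\<lambda>\<omega>. ?X 0 \<omega> * ?X r \<omega>) - a * expectation (?X 0) - a * expectation (?X r) + a * a"
    using int int2 prob_space by simp
  finally show ?thesis
    unfolding E1 E2 by (simp add: a_def algebra_simps)
qed

lemma sum_autocovariance_ge:
  assumes stat: "bind_pmf \<pi> K = \<pi>" and irr: "\<And>i k. \<exists>n. 0 < measure (measure_pmf (step_pmf K n i)) {k}"
    and tail: "eventually (\<lambda>n. real n powr - \<alpha> / 2 \<le> survival K j n j) sequentially"
  shows "\<exists>c>0. \<exists>B. eventually (\<lambda>n. c * real n powr (2 - \<alpha>) - B \<le>
      (\<Sum>r = 1..n. covariance (chain_law K \<pi>) (\<lambda>\<omega>. indicator {i} (\<omega> 0)) (\<lambda>\<omega>. indicator {i} (\<omega> r)))) sequentially"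
proof -
  define W where "W n = (\<Sum>r\<le>n. measure (measure_pmf (step_pmf K r j)) {i})" for n
  define V where "V n = (\<Sum>r\<le>n. measure (measure_pmf (step_pmf K r i)) {i})" for n
  let ?G = "\<lambda>n. \<Sum>r = 1..n. covariance (chain_law K \<pi>) (\<lambda>\<omega>. indicator {i} (\<omega> 0)) (\<lambda>\<omega>. indicator {i} (\<omega> r))"
  have pos: "0 < pmf \<pi> k" for k
    by (rule stationary_pmf_pos[OF stat irr])
  have G: "?G n = pmf \<pi> i * (V n - 1 - real n * pmf \<pi> i)" for n
  proof -
    have "V n = 1 + (\<Sum>r = 1..n. measure (measure_pmf (step_pmf K r i)) {i})"
      unfolding V_def atMost_atLeast0 by (subst sum.atLeast_Suc_atMost) auto
    then show ?thesis
      unfolding covariance_indicator[OF stat] by (simp add: sum_subtractf flip: sum_distrib_left)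
  qed
  obtain B where B: "\<And>n k. k \<noteq> j \<Longrightarrow> (\<Sum>r\<le>n. taboo K j {i} r k) \<le> B"
    using sum_taboo_bounded[OF irr, of j i] by (elim exE) metis
  \<comment> \<open>Starting at \<open>i\<close> gives at least as many visits to \<open>i\<close>
    as starting at \<open>j\<close>. Dropping time 0 costs at most 1, and
    \<open>pmf \<pi> i \<le> 1\<close> keeps the error constant under the multiplication.\<close>
  have lower: "pmf \<pi> i * (avoid K \<pi> j n * W n) - (\<bar>B\<bar> + 1) \<le> ?G n" for n
  proof -
    have "avoid K \<pi> j n * W n - \<bar>B\<bar> \<le> W n - (real n + 1) * pmf \<pi> i"
      using sum_visits_excess[OF stat B, of n] by (simp add: W_def measure_pmf_single)
    moreover have "W n \<le> V n"
      unfolding W_def V_def by (rule sum_visits_self_ge)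
    ultimately have "avoid K \<pi> j n * W n - (\<bar>B\<bar> + 1) \<le> V n - 1 - real n * pmf \<pi> i"
      using pos[of i] by (simp add: algebra_simps)
    then have "pmf \<pi> i * (avoid K \<pi> j n * W n - (\<bar>B\<bar> + 1)) \<le> ?G n"
      unfolding G by (intro mult_left_mono) auto
    moreover have "pmf \<pi> i * (\<bar>B\<bar> + 1) \<le> 1 * (\<bar>B\<bar> + 1)"
      by (intro mult_right_mono pmf_le_1) auto
    ultimately show ?thesis
      by (simp add: right_diff_distrib)
  qed
  obtain c where c: "c > 0" "eventually (\<lambda>n. c * real n \<le> W n) sequentially"
    using sum_visits_linear[OF stat irr, of j i] unfolding W_def by (elim exE conjE) metis
  \<comment> \<open>\<open>avoid_ge\<close> uses the tail at \<open>2 * n\<close>; this is the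
    origin of \<open>2 powr - \<alpha>\<close> in the constant.\<close>
  have "filterlim (\<lambda>n. 2 * n) sequentially (sequentially :: nat filter)"
    by (rule filterlim_subseq) (auto simp: strict_mono_def)
  then have "eventually (\<lambda>n. real (2 * n) powr - \<alpha> / 2 \<le> survival K j (2 * n) j) sequentially"
    using tail by (rule eventually_compose_filterlim[rotated])
  with c(2) eventually_gt_at_top[of 0]
  have "eventually (\<lambda>n. pmf \<pi> i * (pmf \<pi> j * 2 powr - \<alpha> / 2 * c) * real n powr (2 - \<alpha>) - (\<bar>B\<bar> + 1) \<le> ?G n) sequentially"
  proof eventually_elim
    case (elim n)
    have "pmf \<pi> j * (real n * (real (2 * n) powr - \<alpha> / 2)) \<le> pmf \<pi> j * (real n * survival K j (2 * n) j)"
      using elim by (intro mult_left_mono) auto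
    also have "\<dots> \<le> avoid K \<pi> j n"
      by (rule avoid_ge[OF stat])
    finally have "(pmf \<pi> j * (real n * (real (2 * n) powr - \<alpha> / 2))) * (c * real n) \<le> avoid K \<pi> j n * W n"
      using elim c(1) by (intro mult_mono avoid_nonneg) auto
    also have "(pmf \<pi> j * (real n * (real (2 * n) powr - \<alpha> / 2))) * (c * real n)
        = (pmf \<pi> j * 2 powr - \<alpha> / 2 * c) * (real n powr 2 * real n powr - \<alpha>)"
      using elim by (simp add: powr_mult power2_eq_square)
    also have "real n powr 2 * real n powr - \<alpha> = real n powr (2 - \<alpha>)"
      unfolding powr_add[symmetric] by simp
    finally have "pmf \<pi> i * ((pmf \<pi> j * 2 powr - \<alpha> / 2 * c) * real n powr (2 - \<alpha>)) \<le> pmf \<pi> i * (avoid K \<pi> j n * W n)"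
      by (intro mult_left_mono) auto
    then show ?case
      using lower[of n] by (simp only: mult.assoc)
  qed
  moreover have "0 < pmf \<pi> i * (pmf \<pi> j * 2 powr - \<alpha> / 2 * c)"
    using pos c(1) by simp
  ultimately show ?thesis
    by blast
qed

text \<open>If \<open>b < a\<close>, dividing both bounds by \<open>real n powr a\<close> would
  squeeze the positive \<open>c\<close> below a null sequence.\<close>

lemma growth_exponent_le:
  fixes G :: "nat \<Rightarrow> real"
  assumes "0 < a" and "0 < c" and lower: "eventually (\<lambda>n. c * real n powr a - B \<le> G n) sequentially"
    and upper: "limsup (\<lambda>n. ereal (G n / real n powr b)) < \<infinity>"
  shows "a \<le> b"
proof (rule ccontr)
  assume "\<not> a \<le> b"
  obtain C :: nat where "limsup (\<lambda>n. ereal (G n / real n powr b)) < ereal (real C)"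
    using upper less_PInf_Ex_of_nat by auto
  then have "eventually (\<lambda>n. ereal (G n / real n powr b) < ereal (real C)) sequentially"
    by (rule Limsup_lessD)
  with lower eventually_gt_at_top[of 0]
  have "eventually (\<lambda>n. c \<le> B * real n powr (- a) + real C * real n powr (b - a)) sequentially"
  proof eventually_elim
    case (elim n)
    then have "c * real n powr a \<le> B + real C * real n powr b"
      by (simp add: field_simps)
    then have "c * real n powr a * real n powr (- a) \<le> (B + real C * real n powr b) * real n powr (- a)"
      by (rule mult_right_mono) simp
    then show ?case
      using elim by (simp add: distrib_right mult.assoc flip: powr_add)
  qed
  moreover have "(\<lambda>n. B * real n powr (- a) + real C * real n powr (b - a)) \<longlonglongrightarrow> B * 0 + real C * 0"
    using \<open>0 < a\<close> \<open>\<not> a \<le> b\<close>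
    by (intro tendsto_intros tendsto_neg_powr filterlim_real_sequentially) auto
  ultimately have "c \<le> 0"
    using tendsto_lowerbound[of _ _ sequentially c] by fastforce
  then show False
    using \<open>0 < c\<close> by simp
qed

lemma tv_dist_bounds:
  assumes "sets M = UNIV" and "\<And>A. \<bar>measure M A - measure N A\<bar> \<le> c"
  shows "0 \<le> tv_dist M N" and "tv_dist M N \<le> c"
proof -
  \<comment> \<open>Boundedness gives the real supremum its meaning; the empty set then shows
    nonnegativity.\<close>
  have "bdd_above ((\<lambda>A. \<bar>measure M A - measure N A\<bar>) ` sets M)"
    using assms(2) by (intro bdd_aboveI2)
  then have "\<bar>measure M {} - measure N {}\<bar> \<le> tv_dist M N"
    unfolding tv_dist_def by (intro cSUP_upper) auto
  then show "0 \<le> tv_dist M N"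
    by simp
  show "tv_dist M N \<le> c"
    unfolding tv_dist_def using assms(1) by (intro cSUP_least assms(2)) auto
qed

theorem theorem1:
  fixes K :: "'s::countable \<Rightarrow> 's pmf" and \<pi> :: "'s pmf" and j :: 's and \<alpha> H :: real
  assumes "irreducible_chain K" and "aperiodic_chain K" and "positive_recurrent K"
    and "stationary_distribution K \<pi>"
    and "long_range_dependent K \<pi>" and "has_hurst_parameter K \<pi> H"
    and "1 < \<alpha>" and "\<alpha> < 2"
    and "(\<lambda>n. measure (chain_law K (return_pmf j)) {\<omega>. return_time j \<omega> > enat n})
           \<sim>[sequentially] (\<lambda>n. real n powr (- \<alpha>))"
  shows "\<forall>\<beta> i. H < \<beta> \<and> \<beta> < 1 \<longrightarrow>
           (\<lambda>n. real n powr (2 - 2 * \<beta>) * tv_dist (nstep K n i) (measure_pmf \<pi>)) \<longlonglongrightarrow> 0"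
proof (intro allI impI)
  fix \<beta> i assume \<beta>: "H < \<beta> \<and> \<beta> < 1"
  have irr: "\<exists>n. 0 < measure (measure_pmf (step_pmf K n i)) {k}" for i k
    using assms(1) unfolding irreducible_chain_def nstep_eq_step_pmf by auto
  have aper: "Gcd {n. n \<ge> 1 \<and> 0 < measure (measure_pmf (step_pmf K n j)) {j}} = 1"
    using assms(2) unfolding aperiodic_chain_def nstep_eq_step_pmf by auto
  have stat: "bind_pmf \<pi> K = \<pi>"
    using assms(4) unfolding stationary_distribution_def .

  define s where "s n = survival K j n j" for n
  have "s \<sim>[sequentially] (\<lambda>n. real n powr (- \<alpha>))"
    using assms(9) unfolding measure_return_time_gt s_def .
  \<comment> \<open>The convention for a quotient of zeros is harmless: the power is positive for
    \<open>n > 0\<close>.\<close>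
  then have "(\<lambda>n. if s n = 0 \<and> real n powr (- \<alpha>) = 0 then 1 else s n / real n powr (- \<alpha>)) \<longlonglongrightarrow> 1"
    unfolding asymp_equiv_def .
  then have "eventually (\<lambda>n. dist (if s n = 0 \<and> real n powr (- \<alpha>) = 0 then 1 else s n / real n powr (- \<alpha>)) 1 < 1 / 2) sequentially"
    by (rule tendstoD) simp
  with eventually_gt_at_top[of 0]
  have tail: "eventually (\<lambda>n. real n powr (- \<alpha>) / 2 \<le> s n \<and> s n \<le> 2 * real n powr (- \<alpha>)) sequentially"
  proof eventually_elim
    case (elim n)
    then have p: "0 < real n powr (- \<alpha>)" and "\<bar>s n / real n powr (- \<alpha>) - 1\<bar> < 1 / 2"
      by (auto simp: dist_real_def)
    then have "1 / 2 \<le> s n / real n powr (- \<alpha>)" "s n / real n powr (- \<alpha>) \<le> 2"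
      by linarith+
    then show ?case
      using p by (simp add: pos_le_divide_eq pos_divide_le_eq)
  qed
  then have tail_lower: "eventually (\<lambda>n. real n powr - \<alpha> / 2 \<le> survival K j n j) sequentially"
    unfolding s_def by eventually_elim simp

  obtain i' where "hurst (chain_law K \<pi>) (\<lambda>k \<omega>. indicator {i'} (\<omega> k)) = ereal H"
    using assms(6) unfolding has_hurst_parameter_def by auto
  \<comment> \<open>An infimum below \<beta> yields an admissible exponent
    \<open>h < \<beta>\<close>; the state \<open>i'\<close> need be neither \<open>i\<close> nor
    \<open>j\<close>.\<close>
  then have "hurst (chain_law K \<pi>) (\<lambda>k \<omega>. indicator {i'} (\<omega> k)) < ereal \<beta>"
    using \<beta> by simp
  then obtain h where h: "h < \<beta>"
    "limsup (\<lambda>n. ereal ((\<Sum>r=1..n. covariance (chain_law K \<pi>) (\<lambda>\<omega>. indicator {i'} (\<omega> 0))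
        (\<lambda>\<omega>. indicator {i'} (\<omega> r))) / real n powr (2 * h - 1))) < \<infinity>"
    unfolding hurst_def Inf_less_iff by auto
  obtain c B where c: "0 < c" and lower: "eventually (\<lambda>n. c * real n powr (2 - \<alpha>) - B \<le>
      (\<Sum>r = 1..n. covariance (chain_law K \<pi>) (\<lambda>\<omega>. indicator {i'} (\<omega> 0)) (\<lambda>\<omega>. indicator {i'} (\<omega> r)))) sequentially"
    using sum_autocovariance_ge[OF stat irr tail_lower, of i'] by (elim exE conjE)
  \<comment> \<open>Comparing growth rates gives \<open>h \<ge> (3 - \<alpha>) / 2\<close>, so the
    required rate \<open>2 - 2 * \<beta>\<close> lies strictly below
    \<open>\<alpha> - 1\<close>.\<close>
  have "2 - \<alpha> \<le> 2 * h - 1"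
    by (rule growth_exponent_le[OF _ c lower h(2)]) (use \<open>\<alpha> < 2\<close> in simp)
  then have gap: "2 - 2 * \<beta> < \<alpha> - 1"
    using h(1) by simp

  \<comment> \<open>The midpoint: below \<open>\<alpha> - 1\<close> for summability of the weighted
    tail, above \<open>2 - 2 * \<beta>\<close> to leave a negative power at the end.\<close>
  define \<delta> where "\<delta> = ((2 - 2 * \<beta>) + (\<alpha> - 1)) / 2"
  have \<delta>: "0 < \<delta>" "2 - 2 * \<beta> < \<delta>" "\<delta> < \<alpha> - 1"
    using gap \<beta> by (auto simp: \<delta>_def)
  have "summable (\<lambda>n. s n * weight \<delta> n)"
  proof (rule summable_comparison_test_ev)
    show "summable (\<lambda>n. 2 * 2 powr \<delta> * real n powr (\<delta> - \<alpha>))"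
      using \<delta> by (intro summable_mult) (simp add: summable_real_powr_iff)
    show "eventually (\<lambda>n. norm (s n * weight \<delta> n) \<le> 2 * 2 powr \<delta> * real n powr (\<delta> - \<alpha>)) sequentially"
      using tail eventually_gt_at_top[of 0]
    proof eventually_elim
      case (elim n)
      have "weight \<delta> n \<le> (2 * real n) powr \<delta>"
        unfolding weight_def using elim \<delta> by (intro powr_mono2) auto
      then have "s n * weight \<delta> n \<le> 2 * real n powr (- \<alpha>) * (2 * real n) powr \<delta>"
        using elim by (intro mult_mono) auto
      also have "\<dots> = 2 * 2 powr \<delta> * (real n powr \<delta> * real n powr (- \<alpha>))"
        by (simp add: powr_mult)
      also have "real n powr \<delta> * real n powr (- \<alpha>) = real n powr (\<delta> - \<alpha>)"
        by (simp flip: powr_add)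
      finally show ?case
        by (simp add: s_def)
    qed
  qed
  then obtain C where C: "\<And>n A. \<bar>measure (measure_pmf (step_pmf K n i)) A - measure (measure_pmf \<pi>) A\<bar> \<le> C / weight \<delta> n"
    using ergodic_rate[OF irr aper stat \<delta>(1), of i] unfolding s_def by blast
  have tv: "0 \<le> tv_dist (nstep K n i) (measure_pmf \<pi>)" "tv_dist (nstep K n i) (measure_pmf \<pi>) \<le> C / weight \<delta> n" for n
    unfolding nstep_eq_step_pmf using tv_dist_bounds[OF _ C] by auto
  show "(\<lambda>n. real n powr (2 - 2 * \<beta>) * tv_dist (nstep K n i) (measure_pmf \<pi>)) \<longlonglongrightarrow> 0"
  proof (rule Lim_null_comparison)
    show "eventually (\<lambda>n. norm (real n powr (2 - 2 * \<beta>) * tv_dist (nstep K n i) (measure_pmf \<pi>))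
        \<le> C * real n powr (2 - 2 * \<beta> - \<delta>)) sequentially"
      using eventually_gt_at_top[of 0]
    proof eventually_elim
      case (elim n)
      have "0 \<le> C"
        using order_trans[OF tv[of 0]] by simp
      moreover have "real n powr \<delta> \<le> weight \<delta> n"
        unfolding weight_def using \<delta> by (intro powr_mono2) auto
      ultimately have "C / weight \<delta> n \<le> C / real n powr \<delta>"
        using elim by (intro divide_left_mono) auto
      then have "tv_dist (nstep K n i) (measure_pmf \<pi>) \<le> C / real n powr \<delta>"
        using tv(2)[of n] by linarith
      then have "real n powr (2 - 2 * \<beta>) * tv_dist (nstep K n i) (measure_pmf \<pi>)
          \<le> real n powr (2 - 2 * \<beta>) * (C / real n powr \<delta>)"
        by (rule mult_left_mono) simp
      also have "\<dots> = C * real n powr (2 - 2 * \<beta> - \<delta>)"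
        by (simp add: powr_diff)
      finally show ?case
        using tv(1)[of n] by simp
    qed
    have "(\<lambda>n. C * real n powr (2 - 2 * \<beta> - \<delta>)) \<longlonglongrightarrow> C * 0"
      using \<delta> by (intro tendsto_intros tendsto_neg_powr filterlim_real_sequentially) auto
    then show "(\<lambda>n. C * real n powr (2 - 2 * \<beta> - \<delta>)) \<longlonglongrightarrow> 0"
      by simp
  qed
qed

end
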